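(* Let $S\colon\mathbb{N}\to\mathbb{Z}^2$ be a two-dimensional random walk, $S(n)=\sum_{i=1}^n X_i$ (so $S(0)=\mathbf{0}$), where $X_1,X_2,\dots$ are i.i.d. copies of a random vector $X$ such that (i) $\mathbb{E}X=\mathbf{0}$ is the zero vector, (ii) the covariance matrix $\mathrm{Cov}(X)=I_2$ is the $2\times2$ identity matrix, (iii) the coordinates of $X$ have finite $(2+\eta)$-th (absolute) moments for some $\eta>0$. Then there is a constant $c\in(0,\infty)$ such that for every $\varepsilon>0$ and every integer $n>0$, $$\mathbb{P}\left(\operatorname{LIS}(S|_{[0,n)})<\varepsilon n^{1/3}\right)\leq c\,\varepsilon.$$ Consequently, for all $n>0$, $$\mathbb{E}\operatorname{LIS}(S|_{[0,n)})\geq\frac{1}{4c}\,n^{1/3}.$$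
   Context: $\mathbb{N}=\{0,1,2,\dots\}$, and $[0,n)$ denotes $\{0,1,\dots,n-1\}$. For $S\colon\mathbb{N}\to\mathbb{R}^d$ and $A\subset\mathbb{N}$, $S|_A$ is called increasing if every coordinate function of $S|_A$ is non-decreasing, i.e. $S(a)\le S(b)$ coordinatewise for all $a,b\in A$ with $a\le b$. Define $\operatorname{LIS}(S|_{[0,n)})=\max\{|A|: A\subset[0,n),\ S|_A \text{ is increasing}\}$. *)

theory Defs
  imports "HOL-Probability.Probability"
begin

text \<open>On vectors, \<open>\<le>\<close> is the coordinatewise order, so \<open>mono_on A S\<close> says that every coordinate
  of \<open>S\<close> restricted to \<open>A\<close> is non-decreasing. The maximum is over a finite set containing \<open>0\<close>.\<close>

definition LIS :: "(nat \<Rightarrow> real ^ 'd) \<Rightarrow> nat \<Rightarrow> nat" where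
  "LIS S n = Max {card A | A. A \<subseteq> {0..<n} \<and> mono_on A S}"

definition random_walk :: "(nat \<Rightarrow> 'a \<Rightarrow> int ^ 'd) \<Rightarrow> 'a \<Rightarrow> nat \<Rightarrow> int ^ 'd" where
  "random_walk X \<omega> n = (\<Sum>i=1..n. X i \<omega>)"

definition real_vec :: "int ^ 'd \<Rightarrow> real ^ 'd" where
  "real_vec v = (\<chi> j. real_of_int (v $ j))"

definition covariance_matrix :: "'a measure \<Rightarrow> ('a \<Rightarrow> real ^ 'd) \<Rightarrow> real ^ 'd ^ 'd" where
  "covariance_matrix M Z = (\<chi> j k.
     integral\<^sup>L M (\<lambda>\<omega>. (Z \<omega> $ j - integral\<^sup>L M (\<lambda>\<omega>'. Z \<omega>' $ j)) *
                         (Z \<omega> $ k - integral\<^sup>L M (\<lambda>\<omega>'. Z \<omega>' $ k))))"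

end

theory Submission
  imports Defs
begin

text \<open>Select times greedily: start at time \<open>0\<close>, and after each selected time wait for the first later time at
which the walk is, in both coordinates, at least where it was when last selected. The selected
times form an increasing subsequence. The waiting times are independent copies of the first time
\<open>\<tau> \<ge> 1\<close> at which the walk is in the closed positive quadrant, and
everything follows from \<open>E (min \<tau> n) \<le> C n\<^bsup>2/3\<^esup>\<close>: by Markov's inequality the sum of \<open>k\<close> waiting
times reaches \<open>n\<close> with probability at most \<open>C k n\<^bsup>-1/3\<^esup>\<close>, and \<open>k\<close> is of order \<open>\<epsilon> n\<^bsup>1/3\<^esup>\<close>.

The exponent comes from the complement of the quadrant, a wedge of angle \<open>3\<pi>/2\<close>. Measuring \<open>\<theta>\<close> from
its axis, \<open>u = r\<^bsup>2/3\<^esup> cos (2\<theta>/3)\<close> is positive and harmonic inside and vanishes on the boundary. For Brownian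
motion killed on leaving the wedge, \<open>u\<close> is a martingale, and \<open>u - u\<^sup>2 / (18 \<rho>) + r\<^sup>2 / (162 \<rho>\<^sup>2)\<close> is a
supermartingale with drift at most a negative multiple of \<open>\<rho>\<^bsup>-2\<^esup>\<close> up to radius \<open>\<rho>\<^bsup>3/2\<^esup>\<close>, since \<open>\<bar>\<nabla> u\<bar>\<^sup>2\<close>
equals \<open>4/9 r\<^bsup>-2/3\<^esup>\<close>. Beyond this radius it is at least \<open>\<rho> / 162\<close>. With \<open>\<rho> = n\<^bsup>1/3\<^esup>\<close> this gives the bound on
the truncated mean of \<open>\<tau>\<close>.

For the walk two corrections are needed. A second-order expansion of \<open>u\<close> has an error of order
\<open>r\<^bsup>2/3 - 2 - \<eta>\<^esup>\<close> (\<open>expectation_hom_cos\<close>), and a step may leave the wedge far beyond its boundary, where \<open>u\<close> is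
negative (\<open>barrier_lower_bound\<close>). Both are absorbed by adding \<open>r\<^sup>q cos (m \<theta>)\<close> with \<open>q < m < 2/3\<close> and \<open>q\<close> close
to \<open>2/3\<close>: this function is positive on the closed wedge without its apex and has a drift of order \<open>- r\<^bsup>q - 2\<^esup>\<close>, which
dominates the errors once \<open>r\<close> is large (\<open>barrier_drift\<close>). Moving the apex into the quadrant makes \<open>r\<close> large
throughout (\<open>quadrant_potential\<close>). The resulting function of the displacement is carried through the
greedy selection one step at a time (\<open>greedy_count_tail\<close>).

The bound on the expectation is the tail bound at \<open>\<epsilon> = 1 / (2 c)\<close>.\<close>

section \<open>Homogeneous functions on a wedge\<close>

lemma powr_one_plus_Taylor2:
  fixes a :: real
  shows "\<exists>M\<ge>0. \<forall>t. cmod t \<le> 1/2 \<longrightarrow>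
    cmod ((1 + t) powr of_real a - (1 + of_real a * t + of_real (a * (a - 1) / 2) * t^2))
      \<le> M * cmod t ^ 3"
proof -
  define f where "f i x = (\<Prod>j<i. of_real a - of_nat j) * (1 + x) powr (of_real a - of_nat i)"
    for i :: nat and x :: complex
  define S where "S = cball (0::complex) (1/2)"
  define B where "B = cmod (\<Prod>j<3. of_real a - of_nat j) * ((1/2) powr (a - 3) + (3/2) powr (a - 3))"
  have re: "Re (1 + x) \<ge> 1/2" "cmod (1 + x) \<ge> 1/2" "cmod (1 + x) \<le> 3/2" if "x \<in> S" for x
  proof -
    have x: "cmod x \<le> 1/2" using that by (simp add: S_def)
    show "Re (1 + x) \<ge> 1/2" using abs_Re_le_cmod[of x] x by simp
    then show "cmod (1 + x) \<ge> 1/2" using complex_Re_le_cmod[of "1+x"] by linarith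
    show "cmod (1 + x) \<le> 3/2" using norm_triangle_ineq[of 1 x] x by simp
  qed
  have der: "(f i has_field_derivative f (Suc i) x) (at x within S)" if "x \<in> S" for i x
  proof -
    have "1 + x \<notin> \<real>\<^sub>\<le>\<^sub>0" using re(1)[OF that] by (auto simp: complex_nonpos_Reals_iff)
    then show ?thesis
      unfolding f_def
      by (auto intro!: derivative_eq_intros simp: algebra_simps)
  qed
  have bnd: "cmod (f (Suc 2) x) \<le> B" if "x \<in> S" for x
  proof -
    have "cmod ((1 + x) powr (of_real a - of_nat 3)) = cmod (1 + x) powr (a - 3)"
      by (subst norm_powr_real_powr') auto
    also have "\<dots> \<le> (1/2) powr (a - 3) + (3/2) powr (a - 3)"
    proof (cases "a \<ge> 3")
      case True
      then have "cmod (1 + x) powr (a - 3) \<le> (3/2) powr (a - 3)"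
        using re[OF that] by (intro powr_mono2) auto
      then show ?thesis using powr_ge_zero[of "1/2" "a-3"] by linarith
    next
      case False
      then have "cmod (1 + x) powr (a - 3) \<le> (1/2) powr (a - 3)"
        using re[OF that] by (intro powr_mono2') auto
      then show ?thesis using powr_ge_zero[of "3/2" "a-3"] by linarith
    qed
    finally show ?thesis
      unfolding f_def B_def norm_mult numeral_3_eq_3[symmetric] numeral_2_eq_2
      by (intro mult_left_mono) (auto simp: numeral_3_eq_3)
  qed
  have "B \<ge> 0" by (auto simp: B_def)
  moreover have "cmod ((1 + t) powr of_real a - (1 + of_real a * t + of_real (a * (a - 1) / 2) * t^2))
      \<le> B * cmod t ^ 3" if "cmod t \<le> 1/2" for t
  proof -
    have "cmod (f 0 t - (\<Sum>i\<le>2. f i 0 * (t - 0) ^ i / (fact i))) \<le> B * cmod (t - 0) ^ (Suc 2) / fact 2"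
      by (rule complex_Taylor[where S = S]) (use that der bnd in \<open>auto simp: S_def\<close>)
    also have "(\<Sum>i\<le>2. f i 0 * (t - 0) ^ i / (fact i)) =
        1 + of_real a * t + of_real (a * (a - 1) / 2) * t^2"
      by (simp add: f_def numeral_2_eq_2 lessThan_Suc algebra_simps)
    also have "f 0 t = (1 + t) powr of_real a" by (simp add: f_def)
    also have "B * cmod (t - 0) ^ (Suc 2) / fact 2 \<le> B * cmod t ^ 3"
      using \<open>B \<ge> 0\<close> by (simp add: numeral_3_eq_3 numeral_2_eq_2)
    finally show ?thesis .
  qed
  ultimately show ?thesis by blast
qed

text \<open>In polar coordinates this is \<open>r\<^sup>\<alpha> cos (\<beta> \<theta>)\<close>, with \<open>\<theta>\<close> cut along the negative real axis. Its
Laplacian is \<open>(\<alpha>\<^sup>2 - \<beta>\<^sup>2) r\<^bsup>\<alpha> - 2\<^esup> cos (\<beta> \<theta>)\<close>: the function is harmonic for \<open>\<alpha> = \<beta>\<close> and, where the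
cosine is positive, strictly superharmonic for \<open>\<alpha> < \<beta>\<close>.\<close>

definition hom_cos :: "real \<Rightarrow> real \<Rightarrow> complex \<Rightarrow> real" where
  "hom_cos \<alpha> \<beta> z = cmod z powr \<alpha> * cos (\<beta> * Arg z)"

lemma hom_cos_0 [simp]: "hom_cos \<alpha> \<beta> 0 = 0"
  by (simp add: hom_cos_def)

lemma abs_hom_cos_le: "\<bar>hom_cos \<alpha> \<beta> z\<bar> \<le> cmod z powr \<alpha>"
  unfolding hom_cos_def abs_mult using abs_cos_le_one[of "\<beta> * Arg z"]
  by (simp add: mult_left_le)

text \<open>The complement of an open quadrant, turned so that the axis of symmetry is the positive real axis.
Its opening angle \<open>3\<pi>/2\<close> is what makes \<open>2/3\<close> the critical exponent: \<open>cos (2\<theta>/3)\<close> vanishes exactly on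
the two boundary rays.\<close>

definition wedge :: "complex set" where
  "wedge = {z. 0 \<le> Re z + \<bar>Im z\<bar>}"

lemma Re_eq_cos_abs_Arg: "Re z = cmod z * cos \<bar>Arg z\<bar>"
proof -
  have "Re z = Re (rcis (cmod z) (Arg z))" by (simp only: rcis_cmod_Arg)
  then show ?thesis by simp
qed

lemma abs_Im_eq_sin_abs_Arg: "\<bar>Im z\<bar> = cmod z * sin \<bar>Arg z\<bar>"
proof -
  have "0 \<le> sin \<bar>Arg z\<bar>" using Arg_bounded[of z] by (intro sin_ge_zero) auto
  have "\<bar>Im z\<bar> = \<bar>Im (rcis (cmod z) (Arg z))\<bar>" by (simp only: rcis_cmod_Arg)
  also have "\<dots> = cmod z * \<bar>sin (Arg z)\<bar>" by (simp add: abs_mult)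
  also have "\<bar>sin (Arg z)\<bar> = \<bar>sin \<bar>Arg z\<bar>\<bar>" by (cases "Arg z \<ge> 0") auto
  finally show ?thesis using \<open>0 \<le> sin \<bar>Arg z\<bar>\<close> by simp
qed

lemma wedge_iff_abs_Arg_le:
  assumes "z \<noteq> 0"
  shows "z \<in> wedge \<longleftrightarrow> \<bar>Arg z\<bar> \<le> 3 * pi / 4"
proof -
  define \<phi> where "\<phi> = \<bar>Arg z\<bar>"
  have \<phi>: "0 \<le> \<phi>" "\<phi> \<le> pi" using Arg_bounded[of z] by (auto simp: \<phi>_def)
  have "Re z + \<bar>Im z\<bar> = cmod z * (cos \<phi> + sin \<phi>)"
    unfolding Re_eq_cos_abs_Arg[of z] abs_Im_eq_sin_abs_Arg[of z] \<phi>_def by (simp add: algebra_simps)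
  also have "\<dots> = cmod z * sqrt 2 * sin (\<phi> + pi / 4)"
    by (simp add: sin_add sin_45 cos_45) (simp add: algebra_simps)
  finally have "z \<in> wedge \<longleftrightarrow> 0 \<le> sin (\<phi> + pi / 4)"
    using assms by (simp add: wedge_def zero_le_mult_iff mult_le_0_iff not_le)
  moreover have "0 \<le> sin (\<phi> + pi / 4)" if "\<phi> \<le> 3 * pi / 4"
    using that \<phi> by (intro sin_ge_zero) auto
  moreover have "sin (\<phi> + pi / 4) < 0" if "\<not> \<phi> \<le> 3 * pi / 4"
    using that \<phi> by (intro sin_lt_zero) auto
  ultimately show ?thesis unfolding \<phi>_def by fastforce
qed

text \<open>A relative displacement of size at most \<open>1/2\<close> turns the argument by less than \<open>\<pi>/4\<close>, so a point of the
wedge does not cross the branch cut.\<close>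

lemma abs_Arg_one_plus_less:
  assumes "cmod t \<le> 1/2"
  shows "\<bar>Arg (1 + t)\<bar> < pi / 4"
proof (rule ccontr)
  assume neg: "\<not> ?thesis"
  define z where "z = 1 + t"
  define \<phi> where "\<phi> = \<bar>Arg z\<bar>"
  have \<phi>: "\<phi> \<ge> pi / 4" "\<phi> \<le> pi" using neg Arg_bounded[of z] by (auto simp: \<phi>_def z_def)
  have "\<bar>Im z\<bar> - Re z = cmod z * (sin \<phi> - cos \<phi>)"
    unfolding Re_eq_cos_abs_Arg[of z] abs_Im_eq_sin_abs_Arg[of z] \<phi>_def by (simp add: algebra_simps)
  also have "\<dots> = cmod z * sqrt 2 * sin (\<phi> - pi / 4)"
    by (simp add: sin_diff sin_45 cos_45) (simp add: algebra_simps)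
  also have "\<dots> \<ge> 0" using \<phi> pi_gt_zero by (intro mult_nonneg_nonneg sin_ge_zero) auto
  finally have "1 \<le> \<bar>Im t\<bar> - Re t" by (simp add: z_def)
  then have *: "1 \<le> (\<bar>Im t\<bar> - Re t)^2" by (simp add: one_le_power)
  have "(Re t)^2 + (Im t)^2 \<le> (1/2)^2"
    using assms by (metis cmod_power2 norm_ge_zero power_mono)
  moreover have "(\<bar>Im t\<bar> - Re t)^2 + (\<bar>Im t\<bar> + Re t)^2 = 2 * ((Re t)^2 + (Im t)^2)"
    by (simp add: power2_eq_square algebra_simps)
  moreover have "0 \<le> (\<bar>Im t\<bar> + Re t)^2" by simp
  ultimately show False using * unfolding power_divide by simp
qed

lemma powr_of_real_eq_rcis:
  assumes "z \<noteq> 0"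
  shows "z powr of_real a = rcis (cmod z powr a) (a * Arg z)"
proof -
  have "Ln z = Complex (ln (cmod z)) (Arg z)"
    using assms by (simp add: complex_eq_iff Arg_eq_Im_Ln)
  then show ?thesis
    using assms by (simp add: powr_def rcis_def cis_conv_exp exp_of_real[symmetric] exp_add[symmetric] 
       Complex_eq algebra_simps)
qed

text \<open>Since \<open>z\<^sup>a * cnj z\<^sup>b\<close> has modulus \<open>r\<^bsup>a + b\<^esup>\<close> and argument \<open>(a - b) \<theta>\<close>, this is the complex factor by
which \<open>hom_cos (a + b) (a - b)\<close> changes when \<open>z\<close> is multiplied by \<open>1 + t\<close>.\<close>

definition hom_mult :: "real \<Rightarrow> real \<Rightarrow> complex \<Rightarrow> complex" where
  "hom_mult a b t = (1 + t) powr of_real a * cnj ((1 + t) powr of_real b)"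

definition hom_Taylor :: "real \<Rightarrow> real \<Rightarrow> complex \<Rightarrow> complex" where
  "hom_Taylor a b t = 1 + of_real a * t + of_real b * cnj t + of_real (a * (a - 1) / 2) * t\<^sup>2
     + of_real (b * (b - 1) / 2) * (cnj t)\<^sup>2 + of_real (a * b) * (t * cnj t)"

lemma hom_cos_mult_one_plus:
  assumes "z \<in> wedge" "z \<noteq> 0" "cmod t \<le> 1/2"
  shows "hom_cos \<alpha> \<beta> (z * (1 + t)) =
    cmod z powr \<alpha> * Re (cis (\<beta> * Arg z) * hom_mult ((\<alpha> + \<beta>) / 2) ((\<alpha> - \<beta>) / 2) t)"
proof -
  have nz: "1 + t \<noteq> 0"
  proof
    assume "1 + t = 0"
    then have "t = -1" by (simp add: add_eq_0_iff)
    then show False using assms(3) by simp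
  qed
  have "Arg (z * (1 + t)) = Arg z + Arg (1 + t)"
  proof -
    have "\<bar>Arg z\<bar> \<le> 3 * pi / 4" using wedge_iff_abs_Arg_le[OF assms(2)] assms(1) by simp
    then have "Arg z + Arg (1 + t) \<in> {-pi<..pi}"
      using abs_Arg_one_plus_less[OF assms(3)] pi_gt_zero unfolding greaterThanAtMost_iff by linarith
    then show ?thesis by (simp add: Arg_times'[OF assms(2) nz])
  qed
  then have "hom_cos \<alpha> \<beta> (z * (1 + t)) =
      cmod z powr \<alpha> * (cmod (1 + t) powr \<alpha> * cos (\<beta> * Arg z + \<beta> * Arg (1 + t)))"
    unfolding hom_cos_def norm_mult by (simp add: powr_mult distrib_left)
  moreover have "hom_mult ((\<alpha> + \<beta>) / 2) ((\<alpha> - \<beta>) / 2) t =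
      rcis (cmod (1 + t) powr \<alpha>) (\<beta> * Arg (1 + t))"
    using nz unfolding hom_mult_def powr_of_real_eq_rcis[OF nz]
    by (simp add: rcis_def cis_cnj cis_mult powr_add[symmetric] field_simps
        flip: of_real_mult)
  ultimately show ?thesis
    by (simp add: rcis_def cos_add sin_add algebra_simps)
qed

text \<open>The product of the second-order expansions of the two factors; the mixed term \<open>a b t cnj t\<close> is the
only one that will survive taking expectations.\<close>

lemma hom_mult_Taylor2:
  "\<exists>M\<ge>0. \<forall>t. cmod t \<le> 1/2 \<longrightarrow> cmod (hom_mult a b t - hom_Taylor a b t) \<le> M * cmod t ^ 3"
proof -
  define a' where "a' = a * (a - 1) / 2"
  define b' where "b' = b * (b - 1) / 2"
  obtain Ma where Ma: "Ma \<ge> 0" "\<And>t. cmod t \<le> 1/2 \<Longrightarrow>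
    cmod ((1 + t) powr of_real a - (1 + of_real a * t + of_real a' * t^2)) \<le> Ma * cmod t ^ 3"
    using powr_one_plus_Taylor2[of a] unfolding a'_def by blast
  obtain Mb where Mb: "Mb \<ge> 0" "\<And>t. cmod t \<le> 1/2 \<Longrightarrow>
    cmod ((1 + t) powr of_real b - (1 + of_real b * t + of_real b' * t^2)) \<le> Mb * cmod t ^ 3"
    using powr_one_plus_Taylor2[of b] unfolding b'_def by blast
  define A where "A = 1 + \<bar>a\<bar> + \<bar>a'\<bar>"
  define B where "B = 1 + \<bar>b\<bar> + \<bar>b'\<bar>"
  define M where "M = (\<bar>a * b'\<bar> + \<bar>a' * b\<bar> + \<bar>a' * b'\<bar>) + A * Mb + Ma * B + Ma * Mb"
  have M0: "M \<ge> 0" using Ma(1) Mb(1) by (simp add: M_def A_def B_def)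
  have "cmod (hom_mult a b t - hom_Taylor a b t) \<le> M * cmod t ^ 3" if t: "cmod t \<le> 1/2" for t
  proof -
    define r where "r = cmod t"
    have r: "0 \<le> r" "r \<le> 1/2" "r \<le> 1" using t by (auto simp: r_def)
    define f where "f = 1 + of_real a * t + of_real a' * t^2"
    define g where "g = 1 + of_real b * cnj t + of_real b' * (cnj t)^2"
    define e1 where "e1 = (1 + t) powr of_real a - f"
    define e2 where "e2 = cnj ((1 + t) powr of_real b) - g"
    have e1: "cmod e1 \<le> Ma * r^3" unfolding e1_def f_def r_def using Ma(2)[OF t] .
    have "e2 = cnj ((1 + t) powr of_real b - (1 + of_real b * t + of_real b' * t^2))"
      by (simp add: e2_def g_def)
    then have e2: "cmod e2 \<le> Mb * r^3" unfolding r_def using Mb(2)[OF t] by (simp only: complex_mod_cnj)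
    have r2: "r\<^sup>2 \<le> 1" using r by (simp add: power_le_one)
    have r3: "r^3 \<le> 1" using r by (simp add: power_le_one)
    have f: "cmod f \<le> A"
    proof -
      have "cmod f \<le> 1 + \<bar>a\<bar> * r + \<bar>a'\<bar> * r^2"
        unfolding f_def r_def
        by (intro norm_triangle_le add_mono) (auto simp: norm_mult norm_power)
      also have "\<dots> \<le> A" unfolding A_def using r r2
        by (intro add_mono order_refl mult_left_le) auto
      finally show ?thesis .
    qed
    have g: "cmod g \<le> B"
    proof -
      have "cmod g \<le> 1 + \<bar>b\<bar> * r + \<bar>b'\<bar> * r^2"
        unfolding g_def r_def
        by (intro norm_triangle_le add_mono) (auto simp: norm_mult norm_power)
      also have "\<dots> \<le> B" unfolding B_def using r r2
        by (intro add_mono order_refl mult_left_le) auto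
      finally show ?thesis .
    qed
    have "hom_mult a b t = (f + e1) * (g + e2)"
      by (simp add: hom_mult_def e1_def e2_def)
    then have eq: "hom_mult a b t - hom_Taylor a b t =
        of_real (a * b') * (t * (cnj t)^2) + of_real (a' * b) * (t^2 * cnj t)
        + of_real (a' * b') * (t^2 * (cnj t)^2) + f * e2 + e1 * g + e1 * e2"
      unfolding hom_Taylor_def f_def g_def a'_def[symmetric] b'_def[symmetric] of_real_mult power2_eq_square
      by (simp only: ring_distribs mult_ac add_ac) (simp add: algebra_simps)
    have "cmod (hom_mult a b t - hom_Taylor a b t) \<le>
        \<bar>a * b'\<bar> * r^3 + \<bar>a' * b\<bar> * r^3 + \<bar>a' * b'\<bar> * r^3 + A * (Mb * r^3) + (Ma * r^3) * B
        + (Ma * r^3) * (Mb * r^3)"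
      unfolding eq
    proof (intro norm_triangle_le add_mono)
      show "cmod (of_real (a * b') * (t * (cnj t)\<^sup>2)) \<le> \<bar>a * b'\<bar> * r ^ 3"
        by (simp add: norm_mult norm_power r_def power2_eq_square power3_eq_cube abs_mult)
      show "cmod (of_real (a' * b) * (t\<^sup>2 * cnj t)) \<le> \<bar>a' * b\<bar> * r ^ 3"
        by (simp add: norm_mult norm_power r_def power2_eq_square power3_eq_cube abs_mult)
      have "r^2 * r^2 \<le> r^3" using r by (simp add: power2_eq_square power3_eq_cube mult_left_le mult_mono)
      then show "cmod (of_real (a' * b') * (t\<^sup>2 * (cnj t)\<^sup>2)) \<le> \<bar>a' * b'\<bar> * r ^ 3"
        by (simp add: norm_mult norm_power r_def abs_mult mult_left_mono)
      show "cmod (f * e2) \<le> A * (Mb * r^3)" unfolding norm_mult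
        using f e2 by (intro mult_mono) (auto simp: A_def)
      show "cmod (e1 * g) \<le> (Ma * r^3) * B" unfolding norm_mult
        using g e1 Ma(1) r by (intro mult_mono) auto
      show "cmod (e1 * e2) \<le> (Ma * r^3) * (Mb * r^3)" unfolding norm_mult
        using e2 e1 Ma(1) r by (intro mult_mono) auto
    qed
    also have "(Ma * r^3) * (Mb * r^3) \<le> Ma * Mb * r^3"
    proof -
      have "Ma * Mb * r^3 * r^3 \<le> Ma * Mb * r^3"
        using r r3 Ma(1) Mb(1) by (intro mult_left_le) auto
      then show ?thesis by (simp add: mult_ac)
    qed
    finally show ?thesis by (simp add: M_def r_def algebra_simps)
  qed
  then show ?thesis using M0 by blast
qed

section \<open>Second-order expansion with a remainder of order \<open>2 + \<eta>\<close>\<close>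

lemma powr_le_8_powr:
  fixes t s e :: real
  assumes "1/2 \<le> t" "0 \<le> s" "s \<le> e" "e \<le> 3"
  shows "t powr s \<le> 8 * t powr e"
proof -
  have "t powr s \<le> (2 * t) powr s" using assms by (intro powr_mono2) auto
  also have "\<dots> \<le> (2 * t) powr e" using assms by (intro powr_mono) auto
  also have "\<dots> = 2 powr e * t powr e" using assms by (simp add: powr_mult)
  also have "(2::real) powr e \<le> 2 powr 3" using assms by (intro powr_mono) auto
  finally show ?thesis using assms by (simp add: mult_right_mono)
qed

lemma power_le_8_powr:
  fixes t e :: real
  assumes "1/2 \<le> t" "real k \<le> e" "e \<le> 3"
  shows "t ^ k \<le> 8 * t powr e"
  using powr_le_8_powr[of t "real k" e] assms by (simp add: powr_realpow)

lemma norm_of_real_mult_le: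
  "cmod x \<le> E \<Longrightarrow> cmod (of_real c * x) \<le> \<bar>c\<bar> * E"
  by (simp add: norm_mult mult_left_mono)

text \<open>By homogeneity only \<open>t = w/z\<close> matters. For \<open>\<bar>t\<bar> \<le> 1/2\<close> the cubic remainder is at most \<open>\<bar>t\<bar>\<^bsup>2 + \<eta>\<^esup>\<close>. For
larger \<open>t\<close> nothing has to cancel: the function and each term of the expansion are separately bounded
by a multiple of \<open>\<bar>t\<bar>\<^bsup>2 + \<eta>\<^esup>\<close>. This is the form in which a moment of order \<open>2 + \<eta>\<close> controls the error,
including the rare long jumps.\<close>

lemma hom_cos_Taylor:
  assumes \<alpha>: "0 \<le> \<alpha>" "\<alpha> \<le> 2" and \<eta>: "0 < \<eta>" "\<eta> \<le> 1"
  shows "\<exists>M\<ge>0. \<forall>z w. z \<in> wedge \<longrightarrow> z \<noteq> 0 \<longrightarrow>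
    \<bar>hom_cos \<alpha> \<beta> (z + w) - cmod z powr \<alpha> * Re (cis (\<beta> * Arg z) * hom_Taylor ((\<alpha> + \<beta>) / 2) ((\<alpha> - \<beta>) / 2) (w / z))\<bar>
      \<le> M * (cmod z powr \<alpha> * (cmod w / cmod z) powr (2 + \<eta>))"
proof -
  define a where "a = (\<alpha> + \<beta>) / 2"
  define b where "b = (\<alpha> - \<beta>) / 2"
  obtain M1 where M1: "M1 \<ge> 0" "\<And>t. cmod t \<le> 1/2 \<Longrightarrow> cmod (hom_mult a b t - hom_Taylor a b t) \<le> M1 * cmod t ^ 3"
    using hom_mult_Taylor2 by blast
  define N where "N = 1 + \<bar>a\<bar> + \<bar>b\<bar> + \<bar>a * (a - 1) / 2\<bar> + \<bar>b * (b - 1) / 2\<bar> + \<bar>a * b\<bar>"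
  define M where "M = M1 + 72 + 8 * N"
  have "M \<ge> 0" using M1(1) by (simp add: M_def N_def)
  moreover have "\<bar>hom_cos \<alpha> \<beta> (z + w) - cmod z powr \<alpha> * Re (cis (\<beta> * Arg z) * hom_Taylor a b (w / z))\<bar>
      \<le> M * (cmod z powr \<alpha> * (cmod w / cmod z) powr (2 + \<eta>))"
    if z: "z \<in> wedge" "z \<noteq> 0" for z w
  proof -
    define t where "t = w / z"
    define r where "r = cmod t"
    have r: "r \<ge> 0" "r = cmod w / cmod z" by (auto simp: r_def t_def norm_divide)
    have zw: "z + w = z * (1 + t)" using z by (simp add: t_def field_simps)
    have main: "\<bar>hom_cos \<alpha> \<beta> (z + w) - cmod z powr \<alpha> * Re (cis (\<beta> * Arg z) * hom_Taylor a b t)\<bar>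
      \<le> cmod z powr \<alpha> * (M * r powr (2 + \<eta>))"
    proof (cases "r \<le> 1/2")
      case True
      have "hom_cos \<alpha> \<beta> (z + w) - cmod z powr \<alpha> * Re (cis (\<beta> * Arg z) * hom_Taylor a b t)
          = cmod z powr \<alpha> * Re (cis (\<beta> * Arg z) * (hom_mult a b t - hom_Taylor a b t))"
        unfolding zw hom_cos_mult_one_plus[OF z True[unfolded r_def]] a_def b_def
        by (simp add: algebra_simps)
      then have "\<bar>hom_cos \<alpha> \<beta> (z + w) - cmod z powr \<alpha> * Re (cis (\<beta> * Arg z) * hom_Taylor a b t)\<bar>
          = cmod z powr \<alpha> * \<bar>Re (cis (\<beta> * Arg z) * (hom_mult a b t - hom_Taylor a b t))\<bar>"
        by (simp add: abs_mult)
      also have "\<dots> \<le> cmod z powr \<alpha> * cmod (cis (\<beta> * Arg z) * (hom_mult a b t - hom_Taylor a b t))"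
        by (intro mult_left_mono abs_Re_le_cmod) auto
      also have "cmod (cis (\<beta> * Arg z) * (hom_mult a b t - hom_Taylor a b t)) \<le> M1 * r ^ 3"
        unfolding norm_mult norm_cis r_def using M1(2)[of t] True by (simp add: r_def)
      also have "r ^ 3 \<le> r powr (2 + \<eta>)"
      proof (cases "r = 0")
        case False
        then have "r ^ 3 = r powr 3" using r(1) by (simp add: powr_realpow)
        also have "\<dots> \<le> r powr (2 + \<eta>)" using True r(1) \<eta> by (intro powr_mono') auto
        finally show ?thesis .
      qed simp
      also have "M1 * r powr (2 + \<eta>) \<le> M * r powr (2 + \<eta>)"
        by (intro mult_right_mono) (auto simp: M_def N_def)
      finally show ?thesis using M1(1) by (simp add: mult_left_mono)
    next
      case False
      then have half: "1/2 \<le> r" by simp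
      have "\<bar>hom_cos \<alpha> \<beta> (z + w)\<bar> \<le> cmod (z + w) powr \<alpha>" by (rule abs_hom_cos_le)
      also have "cmod (z + w) \<le> cmod z * (3 * r)"
      proof -
        have "cmod (z + w) \<le> cmod z * (1 + r)"
          unfolding zw norm_mult r_def using norm_triangle_ineq[of 1 t] by (intro mult_left_mono) auto
        also have "\<dots> \<le> cmod z * (3 * r)" using half by (intro mult_left_mono) auto
        finally show ?thesis .
      qed
      then have "cmod (z + w) powr \<alpha> \<le> (cmod z * (3 * r)) powr \<alpha>" using \<alpha> by (intro powr_mono2) auto
      also have "\<dots> = cmod z powr \<alpha> * (3 powr \<alpha> * r powr \<alpha>)" using half by (simp add: powr_mult)
      also have "\<dots> \<le> cmod z powr \<alpha> * (9 * (8 * r powr (2 + \<eta>)))"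
      proof (intro mult_left_mono mult_mono)
        have "(3::real) powr \<alpha> \<le> 3 powr 2" using \<alpha> by (intro powr_mono) auto
        then show "(3::real) powr \<alpha> \<le> 9" by simp
        show "r powr \<alpha> \<le> 8 * r powr (2 + \<eta>)" using half \<alpha> \<eta> by (intro powr_le_8_powr) auto
      qed auto
      finally have 1: "\<bar>hom_cos \<alpha> \<beta> (z + w)\<bar> \<le> cmod z powr \<alpha> * (72 * r powr (2 + \<eta>))" by simp
      define E where "E = 8 * r powr (2 + \<eta>)"
      have E: "1 \<le> E" "r \<le> E" "r\<^sup>2 \<le> E"
        unfolding E_def using power_le_8_powr[OF half, of 0 "2 + \<eta>"] power_le_8_powr[OF half, of 1 "2 + \<eta>"]
          power_le_8_powr[OF half, of 2 "2 + \<eta>"] \<eta> by auto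
      have "cmod (hom_Taylor a b t) \<le> E + \<bar>a\<bar> * E + \<bar>b\<bar> * E + \<bar>a * (a - 1) / 2\<bar> * E + \<bar>b * (b - 1) / 2\<bar> * E + \<bar>a * b\<bar> * E"
        unfolding hom_Taylor_def
        using E
        by (intro norm_triangle_le add_mono norm_of_real_mult_le)
           (auto simp: norm_mult norm_power r_def[symmetric] power2_eq_square)
      also have "\<dots> = 8 * N * r powr (2 + \<eta>)" by (simp add: N_def E_def algebra_simps)
      finally have 2: "cmod (hom_Taylor a b t) \<le> 8 * N * r powr (2 + \<eta>)" .
      have "\<bar>cmod z powr \<alpha> * Re (cis (\<beta> * Arg z) * hom_Taylor a b t)\<bar>
          \<le> cmod z powr \<alpha> * cmod (cis (\<beta> * Arg z) * hom_Taylor a b t)"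
        unfolding abs_mult using abs_Re_le_cmod[of "cis (\<beta> * Arg z) * hom_Taylor a b t"]
        by (simp add: mult_left_mono)
      also have "\<dots> \<le> cmod z powr \<alpha> * (8 * N * r powr (2 + \<eta>))"
        using 2 by (intro mult_left_mono) (auto simp: norm_mult)
      finally have "\<bar>hom_cos \<alpha> \<beta> (z + w) - cmod z powr \<alpha> * Re (cis (\<beta> * Arg z) * hom_Taylor a b t)\<bar>
        \<le> cmod z powr \<alpha> * (72 * r powr (2 + \<eta>)) + cmod z powr \<alpha> * (8 * N * r powr (2 + \<eta>))"
        using 1 by linarith
      also have "\<dots> = cmod z powr \<alpha> * ((72 + 8 * N) * r powr (2 + \<eta>))" by (simp add: algebra_simps)
      also have "\<dots> \<le> cmod z powr \<alpha> * (M * r powr (2 + \<eta>))"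
        using M1(1) by (intro mult_left_mono mult_right_mono) (auto simp: M_def)
      finally show ?thesis .
    qed
    then show ?thesis unfolding t_def r(2) by (simp add: mult_ac)
  qed
  ultimately show ?thesis unfolding a_def b_def by blast
qed

lemma hom_cos_Lipschitz:
  assumes \<alpha>: "0 \<le> \<alpha>" "\<alpha> \<le> 2"
  shows "\<exists>C\<ge>0. \<forall>z w. z \<in> wedge \<longrightarrow> cmod w \<le> cmod z / 2 \<longrightarrow>
    \<bar>hom_cos \<alpha> \<beta> (z + w) - hom_cos \<alpha> \<beta> z\<bar> \<le> C * (cmod z powr \<alpha> * (cmod w / cmod z))"
proof -
  define a where "a = (\<alpha> + \<beta>) / 2"
  define b where "b = (\<alpha> - \<beta>) / 2"
  obtain M where M: "M \<ge> 0" "\<And>t. cmod t \<le> 1/2 \<Longrightarrow> cmod (hom_mult a b t - hom_Taylor a b t) \<le> M * cmod t ^ 3"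
    using hom_mult_Taylor2 by blast
  define N where "N = \<bar>a\<bar> + \<bar>b\<bar> + \<bar>a * (a - 1) / 2\<bar> + \<bar>b * (b - 1) / 2\<bar> + \<bar>a * b\<bar>"
  have "M + N \<ge> 0" using M(1) by (simp add: N_def)
  moreover have "\<bar>hom_cos \<alpha> \<beta> (z + w) - hom_cos \<alpha> \<beta> z\<bar> \<le> (M + N) * (cmod z powr \<alpha> * (cmod w / cmod z))"
    if z: "z \<in> wedge" "cmod w \<le> cmod z / 2" for z w
  proof (cases "z = 0")
    case True
    then show ?thesis using z by simp
  next
    case False
    define t where "t = w / z"
    define r where "r = cmod t"
    have r: "r \<ge> 0" "r = cmod w / cmod z" "r \<le> 1/2"
      using z False by (auto simp: r_def t_def norm_divide field_simps)
    have zw: "z + w = z * (1 + t)" using False by (simp add: t_def field_simps)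
    have "hom_cos \<alpha> \<beta> (z + w) - hom_cos \<alpha> \<beta> z = cmod z powr \<alpha> * Re (cis (\<beta> * Arg z) * (hom_mult a b t - 1))"
      unfolding zw hom_cos_mult_one_plus[OF z(1) False r(3)[unfolded r_def]] a_def b_def
      by (simp add: algebra_simps hom_cos_def)
    then have "\<bar>hom_cos \<alpha> \<beta> (z + w) - hom_cos \<alpha> \<beta> z\<bar> = cmod z powr \<alpha> * \<bar>Re (cis (\<beta> * Arg z) * (hom_mult a b t - 1))\<bar>"
      by (simp add: abs_mult)
    also have "\<dots> \<le> cmod z powr \<alpha> * cmod (cis (\<beta> * Arg z) * (hom_mult a b t - 1))"
      by (intro mult_left_mono abs_Re_le_cmod) auto
    also have "cmod (cis (\<beta> * Arg z) * (hom_mult a b t - 1)) = cmod (hom_mult a b t - 1)"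
      by (simp add: norm_mult)
    also have "cmod (hom_mult a b t - 1) \<le> cmod (hom_mult a b t - hom_Taylor a b t) + cmod (hom_Taylor a b t - 1)"
      by (rule norm_diff_triangle_ineq[of "hom_mult a b t" "hom_Taylor a b t" "hom_Taylor a b t" 1, simplified])
    also have "cmod (hom_mult a b t - hom_Taylor a b t) \<le> M * r"
    proof -
      have "cmod (hom_mult a b t - hom_Taylor a b t) \<le> M * r ^ 3"
        using M(2)[of t] r(3) by (simp add: r_def)
      also have "r ^ 3 \<le> r" using r(1,3) power_decreasing[of 1 3 r] by simp
      finally show ?thesis using M(1) by (simp add: mult_left_mono)
    qed
    also have "cmod (hom_Taylor a b t - 1) \<le> \<bar>a\<bar> * r + \<bar>b\<bar> * r + \<bar>a * (a - 1) / 2\<bar> * r + \<bar>b * (b - 1) / 2\<bar> * r + \<bar>a * b\<bar> * r"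
    proof -
      have r2: "r * r \<le> r" using r(1,3) by (simp add: mult_left_le)
      have "hom_Taylor a b t - 1 = of_real a * t + of_real b * cnj t + of_real (a * (a - 1) / 2) * t\<^sup>2
         + of_real (b * (b - 1) / 2) * (cnj t)\<^sup>2 + of_real (a * b) * (t * cnj t)"
        by (simp add: hom_Taylor_def)
      also have "cmod \<dots> \<le> \<bar>a\<bar> * r + \<bar>b\<bar> * r + \<bar>a * (a - 1) / 2\<bar> * r + \<bar>b * (b - 1) / 2\<bar> * r + \<bar>a * b\<bar> * r"
        using r2
        by (intro norm_triangle_le add_mono norm_of_real_mult_le)
           (auto simp: norm_mult norm_power r_def[symmetric] power2_eq_square)
      finally show ?thesis .
    qed
    also have "M * r + (\<bar>a\<bar> * r + \<bar>b\<bar> * r + \<bar>a * (a - 1) / 2\<bar> * r + \<bar>b * (b - 1) / 2\<bar> * r + \<bar>a * b\<bar> * r) = (M + N) * r"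
      by (simp add: N_def algebra_simps)
    finally have "\<bar>hom_cos \<alpha> \<beta> (z + w) - hom_cos \<alpha> \<beta> z\<bar> \<le> cmod z powr \<alpha> * ((M + N) * r)"
      by (simp add: mult_left_mono)
    then show ?thesis unfolding r(2) by (simp add: mult_ac)
  qed
  ultimately show ?thesis by blast
qed

section \<open>Expectation after one isotropic step\<close>

lemma borel_measurable_Arg [measurable]: "Arg \<in> borel_measurable borel"
proof -
  have "(\<lambda>z. indicator (- \<real>\<^sub>\<le>\<^sub>0) z *\<^sub>R Arg z) \<in> borel_measurable borel"
    by (intro borel_measurable_continuous_on_indicator continuous_on_Arg)
       (auto intro!: borel_comp borel_closed closed_nonpos_Reals_complex)
  moreover have "(\<lambda>z::complex. pi * indicator (\<real>\<^sub>\<le>\<^sub>0 - {0}) z) \<in> borel_measurable borel"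
    by (intro borel_measurable_times borel_measurable_const borel_measurable_indicator sets.Diff
         borel_closed closed_nonpos_Reals_complex) auto
  ultimately have "(\<lambda>z. indicator (- \<real>\<^sub>\<le>\<^sub>0) z *\<^sub>R Arg z + pi * indicator (\<real>\<^sub>\<le>\<^sub>0 - {0}) z) \<in> borel_measurable borel"
    by (rule borel_measurable_add)
  also have "(\<lambda>z. indicator (- \<real>\<^sub>\<le>\<^sub>0) z *\<^sub>R Arg z + pi * indicator (\<real>\<^sub>\<le>\<^sub>0 - {0}) z) = Arg"
  proof
    fix z :: complex
    have "Arg z = pi" if "z \<in> \<real>\<^sub>\<le>\<^sub>0" "z \<noteq> 0"
      using that by (auto simp: Arg_eq_pi complex_nonpos_Reals_iff complex_eq_iff)
    then show "indicator (- \<real>\<^sub>\<le>\<^sub>0) z *\<^sub>R Arg z + pi * indicator (\<real>\<^sub>\<le>\<^sub>0 - {0}) z = Arg z"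
      by (cases "z = 0") (auto simp: indicator_def Arg_zero)
  qed
  finally show ?thesis .
qed

lemma borel_measurable_hom_cos [measurable]: "hom_cos \<alpha> \<beta> \<in> borel_measurable borel"
  unfolding hom_cos_def[abs_def] by measurable

text \<open>The condition \<open>E \<xi>\<^sup>2 = 0\<close> says that the real and the imaginary part are uncorrelated and have equal
variance. The value \<open>4\<close> comes from the coordinates used below, which rotate the plane and stretch it by
\<open>\<surd>2\<close>.\<close>

locale isotropic_step = prob_space M for M :: "'a measure" +
  fixes \<xi> :: "'a \<Rightarrow> complex" and \<eta> :: real
  assumes measurable_step [measurable]: "\<xi> \<in> borel_measurable M"
    and \<eta>: "0 < \<eta>" "\<eta> \<le> 1"
    and integrable_moment: "integrable M (\<lambda>\<omega>. cmod (\<xi> \<omega>) powr (2 + \<eta>))"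
    and mean_0: "expectation \<xi> = 0"
    and square_0: "expectation (\<lambda>\<omega>. (\<xi> \<omega>)\<^sup>2) = 0"
    and norm_square: "expectation (\<lambda>\<omega>. (cmod (\<xi> \<omega>))\<^sup>2) = 4"
begin

lemma integrable_step_power:
  assumes "real k \<le> 2 + \<eta>"
  shows "integrable M (\<lambda>\<omega>. (cmod (\<xi> \<omega>)) ^ k)"
proof (rule Bochner_Integration.integrable_bound)
  show "integrable M (\<lambda>\<omega>. 1 + cmod (\<xi> \<omega>) powr (2 + \<eta>))"
    using integrable_moment by simp
  show "AE \<omega> in M. norm (cmod (\<xi> \<omega>) ^ k) \<le> norm (1 + cmod (\<xi> \<omega>) powr (2 + \<eta>))"
  proof (rule AE_I2)
    fix \<omega>
    show "norm (cmod (\<xi> \<omega>) ^ k) \<le> norm (1 + cmod (\<xi> \<omega>) powr (2 + \<eta>))"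
    proof (cases "cmod (\<xi> \<omega>) \<le> 1")
      case True
      then show ?thesis using power_le_one[of "cmod (\<xi> \<omega>)" k] powr_ge_zero[of "cmod (\<xi> \<omega>)" "2 + \<eta>"]
        by (simp add: add_increasing2)
    next
      case False
      then have "0 < cmod (\<xi> \<omega>)" by linarith
      then have "cmod (\<xi> \<omega>) ^ k = cmod (\<xi> \<omega>) powr real k" by (rule powr_realpow[symmetric])
      also have "\<dots> \<le> cmod (\<xi> \<omega>) powr (2 + \<eta>)" using False assms by (intro powr_mono) auto
      finally show ?thesis by simp
    qed
  qed
qed measurable

lemma integrable_step [simp]: "integrable M \<xi>"
  using integrable_step_power[of 1] \<eta> by (simp add: integrable_norm_iff)

lemma integrable_step_square [simp]: "integrable M (\<lambda>\<omega>. (\<xi> \<omega>)\<^sup>2)"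
  using integrable_step_power[of 2] \<eta>
  by (simp add: norm_power[symmetric] integrable_norm_iff)

lemma integrable_norm_step_square [simp]: "integrable M (\<lambda>\<omega>. (cmod (\<xi> \<omega>))\<^sup>2)"
  using integrable_step_power[of 2] \<eta> by simp

lemma integrable_hom_Taylor: "integrable M (\<lambda>\<omega>. hom_Taylor a b (\<xi> \<omega> / z))"
  and expectation_hom_Taylor:
    "expectation (\<lambda>\<omega>. hom_Taylor a b (\<xi> \<omega> / z)) = 1 + of_real (4 * a * b / (cmod z)\<^sup>2)"
proof -
  have eq: "hom_Taylor a b (\<xi> \<omega> / z) = 1 + of_real a / z * \<xi> \<omega> + of_real b / cnj z * cnj (\<xi> \<omega>)
     + of_real (a * (a - 1) / 2) / z\<^sup>2 * (\<xi> \<omega>)\<^sup>2 + of_real (b * (b - 1) / 2) / (cnj z)\<^sup>2 * cnj ((\<xi> \<omega>)\<^sup>2)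
     + of_real (a * b / (cmod z)\<^sup>2) * of_real ((cmod (\<xi> \<omega>))\<^sup>2)" for \<omega>
  proof -
    have "of_real (a * b) * (\<xi> \<omega> / z * cnj (\<xi> \<omega> / z)) = of_real (a * b / (cmod z)\<^sup>2) * (of_real ((cmod (\<xi> \<omega>))\<^sup>2) :: complex)"
      by (simp only: complex_norm_square[symmetric]) (simp add: norm_divide power_divide)
    then show ?thesis unfolding hom_Taylor_def by (simp add: power_divide)
  qed
  have cnj: "expectation (\<lambda>\<omega>. cnj (\<xi> \<omega>)) = 0" "expectation (\<lambda>\<omega>. cnj ((\<xi> \<omega>)\<^sup>2)) = 0"
    using Bochner_Integration.integral_cnj[of M \<xi>] Bochner_Integration.integral_cnj[of M "\<lambda>\<omega>. (\<xi> \<omega>)\<^sup>2"] by (simp_all only: mean_0 square_0 complex_cnj_zero)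
  have icnj: "integrable M (\<lambda>\<omega>. cnj (\<xi> \<omega>))" "integrable M (\<lambda>\<omega>. cnj ((\<xi> \<omega>)\<^sup>2))"
    by (simp_all only: integrable_cnj integrable_step integrable_step_square)
  note int = integrable_step integrable_step_square icnj integrable_of_real[OF integrable_norm_step_square]
  show "integrable M (\<lambda>\<omega>. hom_Taylor a b (\<xi> \<omega> / z))"
    unfolding eq
    by (intro Bochner_Integration.integrable_add integrable_mult_right int) auto
  have "expectation (\<lambda>\<omega>. complex_of_real ((cmod (\<xi> \<omega>))\<^sup>2)) = 4"
    using norm_square by (simp only: integral_complex_of_real) simp
  then show "expectation (\<lambda>\<omega>. hom_Taylor a b (\<xi> \<omega> / z)) = 1 + of_real (4 * a * b / (cmod z)\<^sup>2)"
    unfolding eq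
    by (subst Bochner_Integration.integral_add,
        (intro Bochner_Integration.integrable_add integrable_mult_right int; simp),
        (intro integrable_mult_right int))+
       (simp add: mean_0 square_0 cnj prob_space del: of_real_power complex_cnj_power)
qed

text \<open>The discrete counterpart of the formula for the Laplacian. In the second-order expansion the terms in
\<open>\<xi>\<close>, \<open>\<xi>\<^sup>2\<close> and their conjugates have mean zero; the term \<open>a b \<bar>\<xi>/z\<bar>\<^sup>2\<close> has mean \<open>4 a b / \<bar>z\<bar>\<^sup>2\<close>, and
\<open>4 a b = \<alpha>\<^sup>2 - \<beta>\<^sup>2\<close>.\<close>

lemma expectation_hom_cos:
  assumes \<alpha>: "0 \<le> \<alpha>" "\<alpha> \<le> 2"
  shows "\<exists>C\<ge>0. \<forall>z. z \<in> wedge \<longrightarrow> z \<noteq> 0 \<longrightarrow>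
    integrable M (\<lambda>\<omega>. hom_cos \<alpha> \<beta> (z + \<xi> \<omega>)) \<and>
    \<bar>expectation (\<lambda>\<omega>. hom_cos \<alpha> \<beta> (z + \<xi> \<omega>)) - hom_cos \<alpha> \<beta> z * (1 + (\<alpha>\<^sup>2 - \<beta>\<^sup>2) / (cmod z)\<^sup>2)\<bar>
      \<le> C * cmod z powr (\<alpha> - 2 - \<eta>)"
proof -
  define a where "a = (\<alpha> + \<beta>) / 2"
  define b where "b = (\<alpha> - \<beta>) / 2"
  have ab: "4 * a * b = \<alpha>\<^sup>2 - \<beta>\<^sup>2" by (simp add: a_def b_def power2_eq_square field_simps)
  obtain C where C: "C \<ge> 0" and Taylor: "\<And>z w. z \<in> wedge \<Longrightarrow> z \<noteq> 0 \<Longrightarrow>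
    \<bar>hom_cos \<alpha> \<beta> (z + w) - cmod z powr \<alpha> * Re (cis (\<beta> * Arg z) * hom_Taylor a b (w / z))\<bar>
      \<le> C * (cmod z powr \<alpha> * (cmod w / cmod z) powr (2 + \<eta>))"
    using hom_cos_Taylor[OF \<alpha> \<eta>, of \<beta>] unfolding a_def b_def by blast
  define m where "m = expectation (\<lambda>\<omega>. cmod (\<xi> \<omega>) powr (2 + \<eta>))"
  have m: "m \<ge> 0" by (simp add: m_def)
  have "integrable M (\<lambda>\<omega>. hom_cos \<alpha> \<beta> (z + \<xi> \<omega>)) \<and>
    \<bar>expectation (\<lambda>\<omega>. hom_cos \<alpha> \<beta> (z + \<xi> \<omega>)) - hom_cos \<alpha> \<beta> z * (1 + (\<alpha>\<^sup>2 - \<beta>\<^sup>2) / (cmod z)\<^sup>2)\<bar>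
      \<le> C * m * cmod z powr (\<alpha> - 2 - \<eta>)" if z: "z \<in> wedge" "z \<noteq> 0" for z
  proof -
    define Q where "Q \<omega> = cmod z powr \<alpha> * Re (cis (\<beta> * Arg z) * hom_Taylor a b (\<xi> \<omega> / z))" for \<omega>
    define err where "err \<omega> = C * cmod z powr (\<alpha> - 2 - \<eta>) * cmod (\<xi> \<omega>) powr (2 + \<eta>)" for \<omega>
    have le: "\<bar>hom_cos \<alpha> \<beta> (z + \<xi> \<omega>) - Q \<omega>\<bar> \<le> err \<omega>" for \<omega>
    proof -
      have "cmod z powr \<alpha> * (cmod (\<xi> \<omega>) / cmod z) powr (2 + \<eta>) = cmod z powr (\<alpha> - 2 - \<eta>) * cmod (\<xi> \<omega>) powr (2 + \<eta>)"
        using z(2) by (simp add: powr_divide powr_diff powr_add field_simps)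
      then show ?thesis using Taylor[OF z, of "\<xi> \<omega>"] unfolding Q_def err_def by (simp add: mult_ac)
    qed
    have iQ: "integrable M Q" unfolding Q_def
      by (intro integrable_mult_right integrable_Re integrable_hom_Taylor)
    have EQ: "expectation Q = hom_cos \<alpha> \<beta> z * (1 + (\<alpha>\<^sup>2 - \<beta>\<^sup>2) / (cmod z)\<^sup>2)"
    proof -
      have i: "integrable M (\<lambda>\<omega>. cis (\<beta> * Arg z) * hom_Taylor a b (\<xi> \<omega> / z))"
        by (intro integrable_mult_right integrable_hom_Taylor)
      have "expectation (\<lambda>\<omega>. cis (\<beta> * Arg z) * hom_Taylor a b (\<xi> \<omega> / z)) =
          cis (\<beta> * Arg z) * (1 + of_real (4 * a * b / (cmod z)\<^sup>2))"
        unfolding expectation_hom_Taylor[symmetric] by (rule Bochner_Integration.integral_mult_right) (rule integrable_hom_Taylor)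
      then have "expectation (\<lambda>\<omega>. Re (cis (\<beta> * Arg z) * hom_Taylor a b (\<xi> \<omega> / z))) =
          Re (cis (\<beta> * Arg z) * (1 + of_real (4 * a * b / (cmod z)\<^sup>2)))"
        using Bochner_Integration.integral_Re[OF i] by simp
      then have "expectation Q = cmod z powr \<alpha> * Re (cis (\<beta> * Arg z) * (1 + of_real (4 * a * b / (cmod z)\<^sup>2)))"
        unfolding Q_def by simp
      also have "\<dots> = cmod z powr \<alpha> * (cos (\<beta> * Arg z) * (1 + (\<alpha>\<^sup>2 - \<beta>\<^sup>2) / (cmod z)\<^sup>2))"
        unfolding ab by simp
      finally show ?thesis by (simp add: hom_cos_def)
    qed
    have ierr: "integrable M err" unfolding err_def using integrable_moment by simp
    have Eerr: "expectation err = C * m * cmod z powr (\<alpha> - 2 - \<eta>)"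
      unfolding err_def m_def by simp
    have "integrable M (\<lambda>\<omega>. hom_cos \<alpha> \<beta> (z + \<xi> \<omega>) - Q \<omega>)"
    proof (rule Bochner_Integration.integrable_bound[OF ierr])
      show "AE \<omega> in M. norm (hom_cos \<alpha> \<beta> (z + \<xi> \<omega>) - Q \<omega>) \<le> norm (err \<omega>)"
        using le by (intro AE_I2) (smt (verit) real_norm_def)
      have "Q \<in> borel_measurable M" using iQ by simp
      then show "(\<lambda>\<omega>. hom_cos \<alpha> \<beta> (z + \<xi> \<omega>) - Q \<omega>) \<in> borel_measurable M" by measurable
    qed
    then have iD: "integrable M (\<lambda>\<omega>. hom_cos \<alpha> \<beta> (z + \<xi> \<omega>) - Q \<omega>)" .
    have "integrable M (\<lambda>\<omega>. (hom_cos \<alpha> \<beta> (z + \<xi> \<omega>) - Q \<omega>) + Q \<omega>)"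
      by (rule Bochner_Integration.integrable_add[OF iD iQ])
    then have i: "integrable M (\<lambda>\<omega>. hom_cos \<alpha> \<beta> (z + \<xi> \<omega>))" by simp
    have "\<bar>expectation (\<lambda>\<omega>. hom_cos \<alpha> \<beta> (z + \<xi> \<omega>)) - expectation Q\<bar> = \<bar>expectation (\<lambda>\<omega>. hom_cos \<alpha> \<beta> (z + \<xi> \<omega>) - Q \<omega>)\<bar>"
      by (simp add: Bochner_Integration.integral_diff[OF i iQ])
    also have "\<dots> \<le> expectation (\<lambda>\<omega>. \<bar>hom_cos \<alpha> \<beta> (z + \<xi> \<omega>) - Q \<omega>\<bar>)" by (rule integral_abs_bound)
    also have "\<dots> \<le> expectation err"
      using iD ierr le by (intro integral_mono) auto
    finally show ?thesis using i unfolding EQ Eerr by simp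
  qed
  then show ?thesis using C m by (intro exI[of _ "C * m"]) simp
qed

end

section \<open>A Lyapunov function for the wedge\<close>

text \<open>The Lyapunov function at time scale \<open>\<rho>\<^sup>3\<close>, that is, at length scale \<open>\<rho>\<^bsup>3/2\<^esup>\<close>. Write \<open>u\<close> for the first term,
the positive harmonic function of the wedge. As \<open>\<Delta> u\<^sup>2 = 2 \<bar>\<nabla> u\<bar>\<^sup>2\<close> and \<open>\<bar>\<nabla> u\<bar>\<close> depends on the radius only, the
second term has a strictly negative drift that does not degenerate near the boundary, where \<open>u\<close>
vanishes. For \<open>q < m < 2/3\<close> the third term is strictly superharmonic and positive up to the boundary;
it absorbs the discretisation errors and the overshoot. The last term keeps the sum nonnegative at
large radii, and its own drift is small enough to be paid by the second term.\<close>

definition barrier :: "real \<Rightarrow> real \<Rightarrow> real \<Rightarrow> complex \<Rightarrow> real" where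
  "barrier q m \<rho> z = hom_cos (2/3) (2/3) z - (hom_cos (2/3) (2/3) z)\<^sup>2 / (18 * \<rho>)
     + hom_cos q m z + (cmod z)\<^sup>2 / (162 * \<rho>\<^sup>2)"

lemma hom_cos_wedge_ge:
  assumes "z \<in> wedge" "0 \<le> m" "m \<le> 2/3"
  shows "cos (3 * pi / 4 * m) * cmod z powr q \<le> hom_cos q m z"
proof (cases "z = 0")
  case False
  have "m * \<bar>Arg z\<bar> \<le> m * (3 * pi / 4)"
    using assms wedge_iff_abs_Arg_le[OF False] by (intro mult_left_mono) auto
  moreover have "m * (3 * pi / 4) \<le> 2/3 * (3 * pi / 4)"
    using assms by (intro mult_right_mono) auto
  then have "m * (3 * pi / 4) \<le> pi" using pi_gt_zero by linarith
  ultimately have "cos (m * (3 * pi / 4)) \<le> cos (m * \<bar>Arg z\<bar>)"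
    using assms by (subst cos_mono_le_eq) (simp_all del: times_divide_eq_right)
  also have "cos (m * \<bar>Arg z\<bar>) = cos (m * Arg z)" by (auto simp: abs_if)
  finally have "cos (m * (3 * pi / 4)) * cmod z powr q \<le> cos (m * Arg z) * cmod z powr q"
    by (intro mult_right_mono) auto
  then show ?thesis unfolding hom_cos_def by (simp add: mult_ac)
qed simp

lemma hom_cos_wedge_nonneg:
  assumes "z \<in> wedge" "0 \<le> m" "m \<le> 2/3"
  shows "0 \<le> hom_cos q m z"
proof -
  have "m * (3 * pi / 4) \<le> 2/3 * (3 * pi / 4)"
    using assms by (intro mult_right_mono) auto
  then have "0 \<le> cos (3 * pi / 4 * m)"
    using assms by (intro cos_ge_zero) (auto intro: order_trans[of _ 0])
  then have "0 \<le> cos (3 * pi / 4 * m) * cmod z powr q" by simp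
  with hom_cos_wedge_ge[OF assms, of q] show ?thesis by linarith
qed

lemma hom_cos_outside_wedge_nonpos:
  assumes "z \<notin> wedge"
  shows "hom_cos q (2/3) z \<le> 0"
proof -
  have "z \<noteq> 0" using assms by (auto simp: wedge_def)
  then have 1: "3 * pi / 4 < \<bar>Arg z\<bar>" using assms wedge_iff_abs_Arg_le by fastforce
  have "0 \<le> cos (pi - 2/3 * \<bar>Arg z\<bar>)"
    using 1 Arg_bounded[of z] by (intro cos_ge_zero) (auto simp: abs_le_iff)
  also have "cos (pi - 2/3 * \<bar>Arg z\<bar>) = - cos (2/3 * \<bar>Arg z\<bar>)" by (simp add: cos_diff)
  also have "cos (2/3 * \<bar>Arg z\<bar>) = cos (2/3 * Arg z)" by (auto simp: abs_if)
  finally show ?thesis by (simp add: hom_cos_def mult_nonneg_nonpos)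
qed

lemma hom_cos_square:
  "(hom_cos \<alpha> \<beta> z)\<^sup>2 = (hom_cos (2 * \<alpha>) 0 z + hom_cos (2 * \<alpha>) (2 * \<beta>) z) / 2"
proof -
  have "(cos (\<beta> * Arg z))\<^sup>2 = (1 + cos (2 * \<beta> * Arg z)) / 2"
    using cos_double_cos[of "\<beta> * Arg z"] by (simp add: mult.assoc)
  moreover have "cmod z powr (2 * \<alpha>) = (cmod z powr \<alpha>)\<^sup>2"
    by (simp add: powr_add[symmetric] power2_eq_square)
  ultimately show ?thesis
    unfolding hom_cos_def power_mult_distrib by (simp only:) (simp add: field_simps)
qed

lemma cmod_square_eq_powr: "(cmod z)\<^sup>2 = (cmod z powr (2/3)) ^ 3"
proof (cases "z = 0")
  case False
  then have "(cmod z powr (2/3)) ^ 3 = (cmod z powr (2/3)) powr real 3"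
    by (intro powr_realpow[symmetric]) simp
  also have "\<dots> = cmod z powr (real 2)" unfolding powr_powr by simp
  also have "\<dots> = (cmod z)\<^sup>2" using False by (subst powr_realpow) auto
  finally show ?thesis by simp
qed simp

text \<open>The first, second and fourth terms of the barrier, with \<open>y = \<bar>z\<bar>\<^bsup>2/3\<^esup>\<close>. Where \<open>u\<close> exceeds \<open>18 \<rho>\<close> the
negative quadratic term dominates \<open>u\<close>, but then \<open>y\<close> is so large that the cubic term wins.\<close>

lemma cubic_bound:
  fixes u y \<rho> :: real
  assumes u: "0 \<le> u" "u \<le> y" and \<rho>: "0 < \<rho>"
  shows "0 \<le> u - u\<^sup>2 / (18 * \<rho>) + y ^ 3 / (162 * \<rho>\<^sup>2)"
    and "\<rho> \<le> y \<Longrightarrow> \<rho> / 162 \<le> u - u\<^sup>2 / (18 * \<rho>) + y ^ 3 / (162 * \<rho>\<^sup>2)"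
proof -
  have *: "0 \<le> u - u\<^sup>2 / (18 * \<rho>) + y ^ 3 / (162 * \<rho>\<^sup>2) \<and>
     (\<rho> \<le> y \<longrightarrow> \<rho> / 162 \<le> u - u\<^sup>2 / (18 * \<rho>) + y ^ 3 / (162 * \<rho>\<^sup>2))"
  proof (cases "u \<le> 18 * \<rho>")
    case True
    have "u * u \<le> u * (18 * \<rho>)" using True u by (intro mult_left_mono) auto
    then have 1: "u\<^sup>2 / (18 * \<rho>) \<le> u" using \<rho> by (simp add: divide_simps power2_eq_square)
    have 2: "\<rho> / 162 \<le> y ^ 3 / (162 * \<rho>\<^sup>2)" if "\<rho> \<le> y"
    proof -
      have "\<rho> ^ 3 \<le> y ^ 3" using that \<rho> by (intro power_mono) auto
      then show ?thesis using \<rho> by (simp add: divide_simps power2_eq_square power3_eq_cube)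
    qed
    have 3: "0 \<le> y ^ 3 / (162 * \<rho>\<^sup>2)" using u by simp
    show ?thesis using 1 2 3 by linarith
  next
    case False
    then have y: "18 * \<rho> \<le> y" using u by linarith
    have "u\<^sup>2 \<le> y\<^sup>2" using u by (intro power_mono) auto
    then have 1: "u\<^sup>2 / (18 * \<rho>) \<le> y\<^sup>2 / (18 * \<rho>)" using \<rho> by (intro divide_right_mono) auto
    have "y\<^sup>2 * (9 * \<rho>) \<le> y\<^sup>2 * y" using y \<rho> by (intro mult_left_mono) auto
    then have 2: "y\<^sup>2 / (18 * \<rho>) \<le> y ^ 3 / (162 * \<rho>\<^sup>2)" using \<rho>
      by (simp add: divide_simps power2_eq_square power3_eq_cube mult_ac) 
    show ?thesis using 1 2 False \<rho> by simp
  qed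
  then show "0 \<le> u - u\<^sup>2 / (18 * \<rho>) + y ^ 3 / (162 * \<rho>\<^sup>2)"
    and "\<rho> \<le> y \<Longrightarrow> \<rho> / 162 \<le> u - u\<^sup>2 / (18 * \<rho>) + y ^ 3 / (162 * \<rho>\<^sup>2)" by auto
qed

lemma barrier_wedge_nonneg:
  assumes "z \<in> wedge" "0 \<le> m" "m \<le> 2/3" "0 < \<rho>"
  shows "0 \<le> barrier q m \<rho> z"
  using cubic_bound(1)[of "hom_cos (2/3) (2/3) z" "cmod z powr (2/3)" \<rho>]
    hom_cos_wedge_nonneg[OF assms(1), of "2/3" "2/3"] abs_hom_cos_le[of "2/3" "2/3" z]
    hom_cos_wedge_nonneg[OF assms(1-3), of q] assms(4)
  unfolding barrier_def cmod_square_eq_powr by auto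

lemma barrier_wedge_ge:
  assumes "z \<in> wedge" "0 \<le> m" "m \<le> 2/3" "0 < \<rho>" "\<rho> \<le> cmod z powr (2/3)"
  shows "\<rho> / 162 \<le> barrier q m \<rho> z"
  using cubic_bound(2)[of "hom_cos (2/3) (2/3) z" "cmod z powr (2/3)" \<rho>]
    hom_cos_wedge_nonneg[OF assms(1), of "2/3" "2/3"] abs_hom_cos_le[of "2/3" "2/3" z]
    hom_cos_wedge_nonneg[OF assms(1-3), of q] assms(4,5)
  unfolding barrier_def cmod_square_eq_powr by auto

lemma barrier_le:
  assumes "1 \<le> \<rho>"
  shows "barrier q m \<rho> z \<le> cmod z powr (2/3) + cmod z powr q + (cmod z)\<^sup>2"
proof -
  have "1 \<le> 162 * \<rho>\<^sup>2" using one_le_power[OF assms, of 2] by linarith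
  then have "(cmod z)\<^sup>2 / (162 * \<rho>\<^sup>2) \<le> (cmod z)\<^sup>2 / 1"
    using assms one_le_power[of \<rho> 2] by (intro divide_left_mono) simp_all
  moreover have "0 \<le> (hom_cos (2/3) (2/3) z)\<^sup>2 / (18 * \<rho>)" using assms by simp
  ultimately show ?thesis
    using abs_hom_cos_le[of "2/3" "2/3" z] abs_hom_cos_le[of q m z] unfolding barrier_def by linarith
qed

text \<open>After a jump out of the wedge the barrier may be negative, but only in a way that is summable against
the jump distribution. Put \<open>r = \<bar>z\<bar>\<close>, \<open>t = \<bar>w\<bar>/r\<close>. A short jump makes \<open>u\<close> no smaller than a negative multiple
of \<open>r\<^bsup>2/3\<^esup> t\<close>, which the positive third term, of order \<open>r\<^sup>q\<close>, compensates unless \<open>t\<close> exceeds a multiple of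
\<open>r\<^bsup>q - 2/3\<^esup>\<close>; in that case \<open>t\<close> is at most a multiple of \<open>t\<^bsup>2 + \<eta>\<^esup>\<close> times the power
\<open>r\<^bsup>(2/3 - q) (1 + \<eta>)\<^esup>\<close>. Long jumps are bounded crudely.\<close>

lemma barrier_lower_bound:
  assumes q: "0 \<le> q" "q \<le> 2/3" and m: "0 \<le> m" "m < 2/3" and \<eta>: "0 < \<eta>" "\<eta> \<le> 1"
  shows "\<exists>C\<ge>0. \<forall>z w \<rho>. z \<in> wedge \<longrightarrow> 1 \<le> cmod z \<longrightarrow> cmod z powr (2/3) \<le> \<rho> \<longrightarrow>
    - (C * (cmod z powr (2/3 + (2/3 - q) * (1 + \<eta>)) * (cmod w / cmod z) powr (2 + \<eta>))) \<le> barrier q m \<rho> (z + w)"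
proof -
  define \<kappa> where "\<kappa> = cos (3 * pi / 4 * m)"
  have "m * (3 * pi / 4) < 2/3 * (3 * pi / 4)" using m by (intro mult_strict_right_mono) auto
  then have \<kappa>: "0 < \<kappa>"
    unfolding \<kappa>_def using m by (intro cos_gt_zero_pi) (auto intro: less_le_trans[of _ 0] simp: mult_ac)
  obtain C1 where C1: "C1 \<ge> 0" "\<And>z w. z \<in> wedge \<Longrightarrow> cmod w \<le> cmod z / 2 \<Longrightarrow>
    \<bar>hom_cos (2/3) (2/3) (z + w) - hom_cos (2/3) (2/3) z\<bar> \<le> C1 * (cmod z powr (2/3) * (cmod w / cmod z))"
    using hom_cos_Lipschitz[of "2/3" "2/3"] by auto
  obtain C2 where C2: "C2 \<ge> 0" "\<And>z w. z \<in> wedge \<Longrightarrow> cmod w \<le> cmod z / 2 \<Longrightarrow>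
    \<bar>hom_cos q m (z + w) - hom_cos q m z\<bar> \<le> C2 * (cmod z powr q * (cmod w / cmod z))"
    using hom_cos_Lipschitz[of q m] q by auto
  define C3 where "C3 = 1 + C1 + C1\<^sup>2 + C2"
  have C3: "C3 > 0" using C1(1) C2(1) by (simp add: C3_def add_pos_nonneg)
  define C where "C = 216 + C3 * (C3 / \<kappa>) powr (1 + \<eta>)"
  have C: "C \<ge> 0" using C3 by (simp add: C_def)
  have "- (C * (cmod z powr (2/3 + (2/3 - q) * (1 + \<eta>)) * (cmod w / cmod z) powr (2 + \<eta>))) \<le> barrier q m \<rho> (z + w)"
    if z: "z \<in> wedge" "1 \<le> cmod z" "cmod z powr (2/3) \<le> \<rho>" for z w \<rho>
  proof -
    define r where "r = cmod z"
    define t where "t = cmod w / r"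
    define y where "y = r powr (2/3)"
    define e where "e = 2/3 + (2/3 - q) * (1 + \<eta>)"
    define U where "U = hom_cos (2/3) (2/3) (z + w)"
    define s where "s = hom_cos q m (z + w)"
    have r: "1 \<le> r" using z by (simp add: r_def)
    have t: "0 \<le> t" using r by (simp add: t_def)
    have y: "1 \<le> y" "y \<le> \<rho>" using r z by (auto simp: y_def r_def ge_one_powr_ge_zero)
    then have \<rho>: "0 < \<rho>" by linarith
    note y = y \<rho>
    have rq: "r powr q \<le> y" unfolding y_def using r q by (intro powr_mono) auto
    have ye: "y \<le> r powr e" unfolding y_def e_def using r q \<eta> by (intro powr_mono) auto
    have bar: "U - U\<^sup>2 / (18 * \<rho>) + s \<le> barrier q m \<rho> (z + w)"
      unfolding barrier_def U_def s_def by simp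
    have rhs: "0 \<le> r powr e * t powr (2 + \<eta>)" by simp
    have "- (C * (r powr e * t powr (2 + \<eta>))) \<le> barrier q m \<rho> (z + w)"
    proof (cases "z + w \<in> wedge")
      case True
      then have "0 \<le> barrier q m \<rho> (z + w)" using m y by (intro barrier_wedge_nonneg) auto
      moreover have "0 \<le> C * (r powr e * t powr (2 + \<eta>))" using C by simp
      ultimately show ?thesis by linarith
    next
      case out: False
      show ?thesis
      proof (cases "t \<le> 1/2")
        case True
        have "cmod w = t * r" using r by (simp add: t_def)
        also have "\<dots> \<le> 1/2 * r" using True r by (intro mult_right_mono) auto
        finally have w: "cmod w \<le> cmod z / 2" by (simp add: r_def)
        \<comment> \<open>Short jump: the value of \<open>u\<close> before it is nonnegative, so Lipschitz continuity bounds how far it drops.\<close>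
        have "0 \<le> hom_cos (2/3) (2/3) z" using z by (intro hom_cos_wedge_nonneg) auto
        then have U1: "- U \<le> C1 * (y * t)"
          using C1(2)[OF z(1) w] unfolding U_def y_def t_def r_def by linarith
        have U0: "U \<le> 0" unfolding U_def using out by (rule hom_cos_outside_wedge_nonpos)
        have "U\<^sup>2 \<le> (C1 * (y * t))\<^sup>2" using U0 U1 by (simp add: abs_le_square_iff[symmetric])
        also have "\<dots> = C1\<^sup>2 * y * (y * t * t)" by (simp add: power2_eq_square algebra_simps)
        also have "\<dots> \<le> C1\<^sup>2 * y * (\<rho> * t * 1)"
          using y t True by (intro mult_left_mono mult_mono) auto
        finally have "U\<^sup>2 \<le> C1\<^sup>2 * (y * t) * \<rho>" by (simp add: mult_ac)
        then have "U\<^sup>2 / \<rho> \<le> C1\<^sup>2 * (y * t)" using y by (simp add: divide_le_eq)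
        moreover have "U\<^sup>2 / (18 * \<rho>) \<le> U\<^sup>2 / \<rho>" using y by (intro divide_left_mono) auto
        ultimately have U2: "U\<^sup>2 / (18 * \<rho>) \<le> C1\<^sup>2 * (y * t)" by linarith
        have "\<kappa> * r powr q \<le> hom_cos q m z"
          unfolding \<kappa>_def r_def using z m by (intro hom_cos_wedge_ge) auto
        then have "\<kappa> * r powr q - C2 * (r powr q * t) \<le> s"
          using C2(2)[OF z(1) w] unfolding s_def t_def r_def by linarith
        moreover have "C2 * (r powr q * t) \<le> C2 * (y * t)"
          using rq t C2(1) by (intro mult_left_mono mult_right_mono) auto
        ultimately have "\<kappa> * r powr q - (C1 + C1\<^sup>2 + C2) * (y * t) \<le> barrier q m \<rho> (z + w)"
          using U1 U2 bar by (simp add: algebra_simps)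
        moreover have "(C1 + C1\<^sup>2 + C2) * (y * t) \<le> C3 * (y * t)"
          using y t by (intro mult_right_mono) (auto simp: C3_def)
        ultimately have main: "\<kappa> * r powr q - C3 * (y * t) \<le> barrier q m \<rho> (z + w)" by linarith
        show ?thesis
        proof (cases "C3 * (y * t) \<le> \<kappa> * r powr q")
          case True
          then have "0 \<le> barrier q m \<rho> (z + w)" using main by linarith
          moreover have "0 \<le> C * (r powr e * t powr (2 + \<eta>))" using C by simp
          ultimately show ?thesis by linarith
        next
          case False
          \<comment> \<open>The ratio of the loss to the compensation; it is at least \<open>1\<close> here, so the loss may be multiplied by \<open>X powr (1 + \<eta>)\<close>.\<close>
          define X where "X = C3 / \<kappa> * (t * r powr (2/3 - q))"
          have t0: "t > 0"
          proof (rule ccontr)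
            assume "\<not> t > 0"
            then have "t = 0" using t by simp
            then show False using False \<kappa> by simp
          qed
          have "X = C3 * (y * t) / (\<kappa> * r powr q)"
            unfolding X_def y_def powr_diff by (simp add: mult_ac)
          moreover have "0 < \<kappa> * r powr q" using \<kappa> r by simp
          ultimately have X: "1 \<le> X" using False by (simp add: pos_le_divide_eq)
          have "C3 * (y * t) * 1 \<le> C3 * (y * t) * X powr (1 + \<eta>)"
            using X \<eta> C3 y t by (intro mult_left_mono ge_one_powr_ge_zero) auto
          also have "X powr (1 + \<eta>) = (C3 / \<kappa>) powr (1 + \<eta>) * (t powr (1 + \<eta>) * r powr ((2/3 - q) * (1 + \<eta>)))"
            unfolding X_def using C3 \<kappa> t r by (simp add: powr_mult powr_powr powr_divide)
          also have "C3 * (y * t) * ((C3 / \<kappa>) powr (1 + \<eta>) * (t powr (1 + \<eta>) * r powr ((2/3 - q) * (1 + \<eta>))))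
             = C3 * (C3 / \<kappa>) powr (1 + \<eta>) * ((r powr (2/3) * r powr ((2/3 - q) * (1 + \<eta>))) * (t powr 1 * t powr (1 + \<eta>)))"
            using t by (simp add: y_def mult_ac)
          also have "\<dots> = C3 * (C3 / \<kappa>) powr (1 + \<eta>) * (r powr e * t powr (2 + \<eta>))"
            unfolding powr_add[symmetric] e_def by simp
          also have "\<dots> \<le> C * (r powr e * t powr (2 + \<eta>))"
            by (intro mult_right_mono rhs) (simp add: C_def)
          finally have "C3 * (y * t) \<le> C * (r powr e * t powr (2 + \<eta>))" by simp
          moreover have "0 \<le> \<kappa> * r powr q" using \<kappa> by simp
          ultimately show ?thesis using main by linarith
        qed
      next
        case False
        have zw: "cmod (z + w) \<le> 3 * (r * t)"
        proof -
          have "cmod w = r * t" using r by (simp add: t_def)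
          then have "cmod (z + w) \<le> r + r * t" using norm_triangle_ineq[of z w] unfolding r_def by simp
          moreover have "r * 1 \<le> r * (2 * t)" using False r by (intro mult_left_mono) auto
          ultimately show ?thesis by simp
        qed
        have pw: "cmod (z + w) powr a \<le> 72 * (r powr a * t powr (2 + \<eta>))" if a: "0 \<le> a" "a \<le> 2" for a
        proof -
          have "cmod (z + w) powr a \<le> (3 * (r * t)) powr a" using zw a by (intro powr_mono2) auto
          also have "\<dots> = r powr a * (3 powr a * t powr a)" using r t by (simp add: powr_mult)
          also have "\<dots> \<le> r powr a * (9 * (8 * t powr (2 + \<eta>)))"
          proof (intro mult_left_mono mult_mono)
            have "(3::real) powr a \<le> 3 powr 2" using a by (intro powr_mono) auto
            then show "(3::real) powr a \<le> 9" by simp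
            show "t powr a \<le> 8 * t powr (2 + \<eta>)" using False a \<eta> by (intro powr_le_8_powr) auto
          qed auto
          finally show ?thesis by simp
        qed
        define T where "T = t powr (2 + \<eta>)"
        have T: "0 \<le> T" by (simp add: T_def)
        have U1: "- U \<le> 72 * (y * T)"
          using pw[of "2/3"] abs_hom_cos_le[of "2/3" "2/3" "z + w"] unfolding U_def y_def T_def by linarith
        have s1: "- s \<le> 72 * (y * T)"
        proof -
          have "- s \<le> 72 * (r powr q * T)"
            using pw[of q] q abs_hom_cos_le[of q m "z + w"] unfolding s_def T_def by linarith
          moreover have "r powr q * T \<le> y * T" using rq T by (rule mult_right_mono)
          ultimately show ?thesis by linarith
        qed
        have U2: "U\<^sup>2 / (18 * \<rho>) \<le> 72 * (y * T)"
        proof -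
          have "U\<^sup>2 \<le> (cmod (z + w) powr (2/3))\<^sup>2"
            using abs_hom_cos_le[of "2/3" "2/3" "z + w"] unfolding U_def
            by (subst abs_le_square_iff[symmetric]) simp
          also have "\<dots> = cmod (z + w) powr (4/3)" by (simp add: power2_eq_square powr_add[symmetric])
          also have "\<dots> \<le> 72 * (r powr (4/3) * T)" unfolding T_def by (intro pw) auto
          also have "r powr (4/3) = y * y" by (simp add: y_def powr_add[symmetric])
          finally have "U\<^sup>2 \<le> 72 * (y * y * T)" .
          also have "\<dots> \<le> 72 * (y * \<rho> * T)"
            using y T by (intro mult_left_mono mult_right_mono) auto
          finally have "U\<^sup>2 \<le> 72 * (y * T) * \<rho>" by (simp add: mult_ac)
          then have "U\<^sup>2 / \<rho> \<le> 72 * (y * T)" using y by (simp add: divide_le_eq)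
          moreover have "U\<^sup>2 / (18 * \<rho>) \<le> U\<^sup>2 / \<rho>" using y by (intro divide_left_mono) auto
          ultimately show ?thesis by linarith
        qed
        have "- (216 * (y * T)) \<le> barrier q m \<rho> (z + w)" using bar U1 U2 s1 by linarith
        moreover have "216 * (y * T) \<le> C * (r powr e * T)"
          using ye T y C3 by (intro mult_mono mult_right_mono mult_nonneg_nonneg C) (auto simp: C_def)
        ultimately show ?thesis unfolding T_def by linarith
      qed
    qed
    then show ?thesis unfolding r_def t_def e_def .
  qed
  then show ?thesis using C by blast
qed

context isotropic_step
begin

text \<open>One step from a point of the wedge at radius between \<open>R\<close> and the length scale lowers the mean of the
barrier by a multiple of \<open>\<rho>\<^bsup>-2\<^esup>\<close>, even when the walk is killed outside an arbitrary event \<open>A\<close>. With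
\<open>q = 2/3 - \<eta>/4\<close> all errors, those of the second-order expansions and that of killing, are of order at most
\<open>r\<^bsup>q - 2 - \<eta>/4\<^esup>\<close>, whereas the third term of the barrier contributes a drift of order \<open>- r\<^bsup>q - 2\<^esup>\<close>. The
latter wins for \<open>r \<ge> R\<close>. What remains is the drift of the second and the last term,
\<open>- 4/(81 \<rho>\<^sup>2) + 2/(81 \<rho>\<^sup>2)\<close>.\<close>

lemma barrier_drift:
  obtains q m R where "0 \<le> q" "0 \<le> m" "m \<le> 2/3" "1 \<le> R"
    and "\<And>z \<rho> A. z \<in> wedge \<Longrightarrow> R \<le> cmod z \<Longrightarrow> cmod z powr (2/3) \<le> \<rho> \<Longrightarrow> A \<in> events \<Longrightarrow>
      expectation (\<lambda>\<omega>. barrier q m \<rho> (z + \<xi> \<omega>) * indicator A \<omega>) \<le> barrier q m \<rho> z - 2 / (81 * \<rho>\<^sup>2)"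
    and "\<And>z \<rho>. z \<in> wedge \<Longrightarrow> R \<le> cmod z \<Longrightarrow> integrable M (\<lambda>\<omega>. barrier q m \<rho> (z + \<xi> \<omega>))"
proof -
  define q where "q = 2/3 - \<eta> / 4"
  define m where "m = 2/3 - \<eta> / 8"
  have qm: "0 \<le> q" "q < m" "m < 2/3" "0 \<le> m" "q \<le> 2/3" "q \<le> 2" using \<eta> by (auto simp: q_def m_def)
  define \<kappa> where "\<kappa> = cos (3 * pi / 4 * m)"
  have "m * (3 * pi / 4) < 2/3 * (3 * pi / 4)" using qm by (intro mult_strict_right_mono) auto
  then have \<kappa>: "0 < \<kappa>"
    unfolding \<kappa>_def using qm by (intro cos_gt_zero_pi) (auto intro: less_le_trans[of _ 0] simp: mult_ac)
  define \<delta> where "\<delta> = (m\<^sup>2 - q\<^sup>2) * \<kappa>"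
  have mq2: "q\<^sup>2 < m\<^sup>2" using qm by (intro power_strict_mono) auto
  have \<delta>: "0 < \<delta>" using \<kappa> mq2 by (simp add: \<delta>_def)
  define \<mu> where "\<mu> = expectation (\<lambda>\<omega>. cmod (\<xi> \<omega>) powr (2 + \<eta>))"
  have \<mu>: "0 \<le> \<mu>" by (simp add: \<mu>_def)
  obtain C1 where C1: "C1 \<ge> 0" "\<And>z. z \<in> wedge \<Longrightarrow> z \<noteq> 0 \<Longrightarrow>
    integrable M (\<lambda>\<omega>. hom_cos (2/3) (2/3) (z + \<xi> \<omega>)) \<and>
    \<bar>expectation (\<lambda>\<omega>. hom_cos (2/3) (2/3) (z + \<xi> \<omega>)) - hom_cos (2/3) (2/3) z * (1 + ((2/3)\<^sup>2 - (2/3)\<^sup>2) / (cmod z)\<^sup>2)\<bar>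
      \<le> C1 * cmod z powr (2/3 - 2 - \<eta>)"
    using expectation_hom_cos[of "2/3" "2/3"] by auto
  obtain C2 where C2: "C2 \<ge> 0" "\<And>z. z \<in> wedge \<Longrightarrow> z \<noteq> 0 \<Longrightarrow>
    integrable M (\<lambda>\<omega>. hom_cos (4/3) 0 (z + \<xi> \<omega>)) \<and>
    \<bar>expectation (\<lambda>\<omega>. hom_cos (4/3) 0 (z + \<xi> \<omega>)) - hom_cos (4/3) 0 z * (1 + ((4/3)\<^sup>2 - 0\<^sup>2) / (cmod z)\<^sup>2)\<bar>
      \<le> C2 * cmod z powr (4/3 - 2 - \<eta>)"
    using expectation_hom_cos[of "4/3" 0] by auto
  obtain C3 where C3: "C3 \<ge> 0" "\<And>z. z \<in> wedge \<Longrightarrow> z \<noteq> 0 \<Longrightarrow>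
    integrable M (\<lambda>\<omega>. hom_cos (4/3) (4/3) (z + \<xi> \<omega>)) \<and>
    \<bar>expectation (\<lambda>\<omega>. hom_cos (4/3) (4/3) (z + \<xi> \<omega>)) - hom_cos (4/3) (4/3) z * (1 + ((4/3)\<^sup>2 - (4/3)\<^sup>2) / (cmod z)\<^sup>2)\<bar>
      \<le> C3 * cmod z powr (4/3 - 2 - \<eta>)"
    using expectation_hom_cos[of "4/3" "4/3"] by auto
  obtain C4 where C4: "C4 \<ge> 0" "\<And>z. z \<in> wedge \<Longrightarrow> z \<noteq> 0 \<Longrightarrow>
    integrable M (\<lambda>\<omega>. hom_cos q m (z + \<xi> \<omega>)) \<and>
    \<bar>expectation (\<lambda>\<omega>. hom_cos q m (z + \<xi> \<omega>)) - hom_cos q m z * (1 + (q\<^sup>2 - m\<^sup>2) / (cmod z)\<^sup>2)\<bar>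
      \<le> C4 * cmod z powr (q - 2 - \<eta>)"
    using expectation_hom_cos[of q m] qm by auto
  define e where "e = 2/3 + (2/3 - q) * (1 + \<eta>)"
  obtain C5 where C5: "C5 \<ge> 0" "\<And>z w \<rho>. z \<in> wedge \<Longrightarrow> 1 \<le> cmod z \<Longrightarrow> cmod z powr (2/3) \<le> \<rho> \<Longrightarrow>
    - (C5 * (cmod z powr e * (cmod w / cmod z) powr (2 + \<eta>))) \<le> barrier q m \<rho> (z + w)"
    using barrier_lower_bound[of q m \<eta>] qm \<eta> unfolding e_def by auto
  define C where "C = C1 + C2 + C3 + C4 + C5 * \<mu>"
  have C: "0 \<le> C" using C1 C2 C3 C4 C5 \<mu> by (simp add: C_def)
  define R where "R = max 1 ((C / \<delta>) powr (4 / \<eta>))"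
  have bar_eq: "barrier q m \<rho> z = hom_cos (2/3) (2/3) z - (hom_cos (4/3) 0 z + hom_cos (4/3) (4/3) z) / (36 * \<rho>)
     + hom_cos q m z + (cmod z)\<^sup>2 / (162 * \<rho>\<^sup>2)" for \<rho> z
    unfolding barrier_def hom_cos_square by simp
  have sq: "(cmod (z + w))\<^sup>2 = (cmod z)\<^sup>2 + 2 * Re (cnj z * w) + (cmod w)\<^sup>2" for z w
    by (simp only: cmod_power2) (simp add: power2_eq_square algebra_simps)
  have int_sq: "integrable M (\<lambda>\<omega>. (cmod (z + \<xi> \<omega>))\<^sup>2)" for z
    unfolding sq
    by (intro Bochner_Integration.integrable_add integrable_mult_right integrable_Re integrable_step) auto
  have exp_sq: "expectation (\<lambda>\<omega>. (cmod (z + \<xi> \<omega>))\<^sup>2) = (cmod z)\<^sup>2 + 4" for z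
  proof -
    define L where "L \<omega> = Re (cnj z * \<xi> \<omega>)" for \<omega>
    have iL: "integrable M L" unfolding L_def by (intro integrable_Re integrable_mult_right integrable_step)
    have "expectation L = Re (cnj z * expectation \<xi>)"
      unfolding L_def by (subst Bochner_Integration.integral_Re) auto
    then have EL: "expectation L = 0" by (simp add: mean_0)
    have "expectation (\<lambda>\<omega>. (cmod z)\<^sup>2 + 2 * L \<omega> + (cmod (\<xi> \<omega>))\<^sup>2) = (cmod z)\<^sup>2 + 4"
      using iL EL by (simp add: norm_square prob_space)
    then show ?thesis unfolding sq L_def .
  qed
  have int_bar: "integrable M (\<lambda>\<omega>. barrier q m \<rho> (z + \<xi> \<omega>))" if "z \<in> wedge" "z \<noteq> 0" for z \<rho>
    unfolding bar_eq
    using C1(2)[OF that] C2(2)[OF that] C3(2)[OF that] C4(2)[OF that] int_sq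
    by (intro Bochner_Integration.integrable_add Bochner_Integration.integrable_diff integrable_divide_zero) auto
  have drift: "expectation (\<lambda>\<omega>. barrier q m \<rho> (z + \<xi> \<omega>) * indicator A \<omega>) \<le> barrier q m \<rho> z - 2 / (81 * \<rho>\<^sup>2)"
    if z: "z \<in> wedge" "R \<le> cmod z" "cmod z powr (2/3) \<le> \<rho>" and A: "A \<in> events" for z \<rho> A
  proof -
    define r where "r = cmod z"
    define y where "y = r powr (2/3)"
    have r: "1 \<le> r" using z by (simp add: r_def R_def)
    then have z0: "z \<noteq> 0" by (auto simp: r_def)
    have y: "1 \<le> y" "y \<le> \<rho>" using r z by (auto simp: y_def r_def ge_one_powr_ge_zero)
    then have \<rho>: "0 < \<rho>" by linarith
    define E where "E = r powr (e - 2 - \<eta>)"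
    have E: "0 \<le> E" by (simp add: E_def)
    have "2/3 \<le> e" unfolding e_def using qm \<eta> by simp
    then have le_E: "r powr (2/3 - 2 - \<eta>) \<le> E" "r powr (q - 2 - \<eta>) \<le> E"
      unfolding E_def using r qm(5) by (auto intro!: powr_mono)
    note I = C1(2)[OF z(1) z0] C2(2)[OF z(1) z0] C3(2)[OF z(1) z0] C4(2)[OF z(1) z0]
    have drift_u: "expectation (\<lambda>\<omega>. hom_cos (2/3) (2/3) (z + \<xi> \<omega>)) \<le> hom_cos (2/3) (2/3) z + C1 * E"
    proof -
      have "C1 * r powr (2/3 - 2 - \<eta>) \<le> C1 * E" using le_E C1(1) by (intro mult_left_mono) auto
      then show ?thesis using I(1) unfolding r_def[symmetric] by (simp add: abs_le_iff)
    qed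
    \<comment> \<open>The squared term, through \<open>u\<^sup>2 = (r\<^bsup>4/3\<^esup> + r\<^bsup>4/3\<^esup> cos (4\<theta>/3)) / 2\<close>; its drift uses \<open>r\<^bsup>2/3\<^esup> \<le> \<rho>\<close>.\<close>
    have drift_sq: "(hom_cos (4/3) 0 z + hom_cos (4/3) (4/3) z) / (36 * \<rho>) + 4 / (81 * \<rho>\<^sup>2) - (C2 + C3) * E
        \<le> (expectation (\<lambda>\<omega>. hom_cos (4/3) 0 (z + \<xi> \<omega>)) + expectation (\<lambda>\<omega>. hom_cos (4/3) (4/3) (z + \<xi> \<omega>))) / (36 * \<rho>)"
    proof -
      have "hom_cos (4/3) 0 z * (16 / 9 / r\<^sup>2) = 16 / 9 / y"
      proof -
        have "hom_cos (4/3) 0 z = y * y" by (simp add: hom_cos_def y_def r_def powr_add[symmetric])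
        moreover have "r\<^sup>2 = y ^ 3" unfolding r_def y_def by (rule cmod_square_eq_powr)
        ultimately show ?thesis using y by (simp add: power3_eq_cube)
      qed
      moreover have "16 / 9 / \<rho> \<le> 16 / 9 / y" using y by (intro divide_left_mono) auto
      moreover have "hom_cos (4/3) 0 z + hom_cos (4/3) 0 z * (16 / 9 / r\<^sup>2) - C2 * r powr (4/3 - 2 - \<eta>) \<le> expectation (\<lambda>\<omega>. hom_cos (4/3) 0 (z + \<xi> \<omega>))"
        using I(2) unfolding r_def[symmetric] by (simp add: distrib_left power2_eq_square abs_le_iff)
      moreover have "hom_cos (4/3) (4/3) z - C3 * r powr (4/3 - 2 - \<eta>) \<le> expectation (\<lambda>\<omega>. hom_cos (4/3) (4/3) (z + \<xi> \<omega>))"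
        using I(3) unfolding r_def[symmetric] by (simp add: abs_le_iff)
      ultimately have "hom_cos (4/3) 0 z + hom_cos (4/3) (4/3) z + 16 / 9 / \<rho> - (C2 + C3) * r powr (4/3 - 2 - \<eta>)
         \<le> expectation (\<lambda>\<omega>. hom_cos (4/3) 0 (z + \<xi> \<omega>)) + expectation (\<lambda>\<omega>. hom_cos (4/3) (4/3) (z + \<xi> \<omega>))"
        by (simp add: algebra_simps)
      then have "(hom_cos (4/3) 0 z + hom_cos (4/3) (4/3) z + 16 / 9 / \<rho> - (C2 + C3) * r powr (4/3 - 2 - \<eta>)) / (36 * \<rho>)
         \<le> (expectation (\<lambda>\<omega>. hom_cos (4/3) 0 (z + \<xi> \<omega>)) + expectation (\<lambda>\<omega>. hom_cos (4/3) (4/3) (z + \<xi> \<omega>))) / (36 * \<rho>)"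
        using \<rho> by (intro divide_right_mono) auto
      moreover have "(C2 + C3) * r powr (4/3 - 2 - \<eta>) / (36 * \<rho>) \<le> (C2 + C3) * E"
      proof -
        have "r powr (4/3 - 2 - \<eta>) = y * r powr (2/3 - 2 - \<eta>)" by (simp add: y_def powr_add[symmetric])
        also have "\<dots> \<le> (36 * \<rho>) * E" using y \<rho> le_E by (intro mult_mono) auto
        finally have "(C2 + C3) * r powr (4/3 - 2 - \<eta>) \<le> (C2 + C3) * ((36 * \<rho>) * E)"
          using C2(1) C3(1) by (intro mult_left_mono) auto
        then show ?thesis using \<rho> by (simp add: pos_divide_le_eq mult_ac)
      qed
      moreover have "16 / 9 / \<rho> / (36 * \<rho>) = 4 / (81 * \<rho>\<^sup>2)" by (simp add: power2_eq_square)
      ultimately show ?thesis by (simp add: add_divide_distrib diff_divide_distrib)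
    qed
    have drift_s: "expectation (\<lambda>\<omega>. hom_cos q m (z + \<xi> \<omega>)) \<le> hom_cos q m z - \<delta> * r powr (q - 2) + C4 * E"
    proof -
      have "C4 * r powr (q - 2 - \<eta>) \<le> C4 * E" using le_E C4(1) by (intro mult_left_mono) auto
      moreover have "\<delta> * r powr (q - 2) \<le> hom_cos q m z * ((m\<^sup>2 - q\<^sup>2) / r\<^sup>2)"
      proof -
        have "r powr (q - 2) = r powr q / r\<^sup>2"
          using r powr_realpow[of r 2] by (simp add: powr_diff)
        then have "\<delta> * r powr (q - 2) = (\<kappa> * r powr q) * ((m\<^sup>2 - q\<^sup>2) / r\<^sup>2)" by (simp add: \<delta>_def)
        also have "\<dots> \<le> hom_cos q m z * ((m\<^sup>2 - q\<^sup>2) / r\<^sup>2)"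
          unfolding \<kappa>_def r_def using z qm mq2 by (intro mult_right_mono hom_cos_wedge_ge) auto
        finally show ?thesis .
      qed
      moreover have "hom_cos q m z * (1 + (q\<^sup>2 - m\<^sup>2) / r\<^sup>2) = hom_cos q m z - hom_cos q m z * ((m\<^sup>2 - q\<^sup>2) / r\<^sup>2)"
        by (simp add: algebra_simps diff_divide_distrib)
      ultimately show ?thesis using I(4) unfolding r_def[symmetric] by (simp only: abs_le_iff) linarith
    qed
    have "expectation (\<lambda>\<omega>. barrier q m \<rho> (z + \<xi> \<omega>)) =
        expectation (\<lambda>\<omega>. hom_cos (2/3) (2/3) (z + \<xi> \<omega>))
        - (expectation (\<lambda>\<omega>. hom_cos (4/3) 0 (z + \<xi> \<omega>)) + expectation (\<lambda>\<omega>. hom_cos (4/3) (4/3) (z + \<xi> \<omega>))) / (36 * \<rho>)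
        + expectation (\<lambda>\<omega>. hom_cos q m (z + \<xi> \<omega>)) + ((cmod z)\<^sup>2 + 4) / (162 * \<rho>\<^sup>2)"
      unfolding bar_eq exp_sq[symmetric] using I int_sq[of z] by simp
    also have "\<dots> \<le> barrier q m \<rho> z - 2 / (81 * \<rho>\<^sup>2) + (C1 + C2 + C3 + C4) * E - \<delta> * r powr (q - 2)"
    proof -
      have "((cmod z)\<^sup>2 + 4) / (162 * \<rho>\<^sup>2) = (cmod z)\<^sup>2 / (162 * \<rho>\<^sup>2) + 4 / (81 * \<rho>\<^sup>2) - 2 / (81 * \<rho>\<^sup>2)"
        using \<rho> by (simp add: field_simps)
      then show ?thesis using drift_u drift_sq drift_s unfolding bar_eq by (simp add: algebra_simps)
    qed
    finally have drift_h: "expectation (\<lambda>\<omega>. barrier q m \<rho> (z + \<xi> \<omega>))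
      \<le> barrier q m \<rho> z - 2 / (81 * \<rho>\<^sup>2) + (C1 + C2 + C3 + C4) * E - \<delta> * r powr (q - 2)" .
    \<comment> \<open>Killing: where the walk is killed, a negative value of the barrier is replaced by \<open>0\<close>, at a cost of at most \<open>N\<close>.\<close>
    define N where "N \<omega> = C5 * E * cmod (\<xi> \<omega>) powr (2 + \<eta>)" for \<omega>
    have N: "- N \<omega> \<le> barrier q m \<rho> (z + \<xi> \<omega>)" "0 \<le> N \<omega>" for \<omega>
    proof -
      have "r powr e * (cmod (\<xi> \<omega>) / r) powr (2 + \<eta>) = E * cmod (\<xi> \<omega>) powr (2 + \<eta>)"
        using r by (simp add: E_def powr_divide powr_diff powr_add field_simps)
      then show "- N \<omega> \<le> barrier q m \<rho> (z + \<xi> \<omega>)"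
        using C5(2)[OF z(1) _ z(3), of "\<xi> \<omega>"] r unfolding N_def r_def by (simp add: mult.assoc)
      show "0 \<le> N \<omega>" using C5(1) E by (simp add: N_def)
    qed
    have iN: "integrable M N" unfolding N_def using integrable_moment by simp
    have EN: "expectation N = C5 * \<mu> * E" unfolding N_def \<mu>_def by simp
    have "expectation (\<lambda>\<omega>. barrier q m \<rho> (z + \<xi> \<omega>) * indicator A \<omega>) \<le> expectation (\<lambda>\<omega>. barrier q m \<rho> (z + \<xi> \<omega>) + N \<omega>)"
    proof (rule integral_mono)
      show "integrable M (\<lambda>\<omega>. barrier q m \<rho> (z + \<xi> \<omega>) * indicator A \<omega>)"
        using A int_bar[OF z(1) z0] by (rule integrable_real_mult_indicator)
      show "integrable M (\<lambda>\<omega>. barrier q m \<rho> (z + \<xi> \<omega>) + N \<omega>)"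
        using iN int_bar[OF z(1) z0] by simp
      show "barrier q m \<rho> (z + \<xi> \<omega>) * indicator A \<omega> \<le> barrier q m \<rho> (z + \<xi> \<omega>) + N \<omega>" for \<omega>
        using N[of \<omega>] by (cases "\<omega> \<in> A") auto
    qed
    also have "\<dots> = expectation (\<lambda>\<omega>. barrier q m \<rho> (z + \<xi> \<omega>)) + C5 * \<mu> * E"
      using iN int_bar[OF z(1) z0] EN by simp
    also have "\<dots> \<le> barrier q m \<rho> z - 2 / (81 * \<rho>\<^sup>2) + C * E - \<delta> * r powr (q - 2)"
      using drift_h by (simp add: C_def algebra_simps)
    also have "C * E \<le> \<delta> * r powr (q - 2)"
    proof -
      have "e - 2 - \<eta> \<le> (q - 2) + - \<eta> / 4"
      proof -
        have "\<eta> * \<eta> \<le> \<eta>" using \<eta> by (simp add: mult_left_le)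
        then show ?thesis by (simp add: e_def q_def algebra_simps)
      qed
      then have "E \<le> r powr ((q - 2) + - \<eta> / 4)" unfolding E_def using r by (intro powr_mono) auto
      also have "\<dots> = r powr (q - 2) / r powr (\<eta> / 4)" by (simp add: powr_diff)
      finally have E1: "E * r powr (\<eta> / 4) \<le> r powr (q - 2)" using r by (simp add: pos_le_divide_eq)
      have "C / \<delta> \<le> r powr (\<eta> / 4)"
      proof (cases "C = 0")
        case False
        then have "C / \<delta> = ((C / \<delta>) powr (4 / \<eta>)) powr (\<eta> / 4)"
          using C \<delta> \<eta> by (simp add: powr_powr)
        also have "\<dots> \<le> r powr (\<eta> / 4)"
          using z(2) \<eta> by (intro powr_mono2) (auto simp: R_def r_def)
        finally show ?thesis .
      qed simp
      then have "C \<le> \<delta> * r powr (\<eta> / 4)" using \<delta> by (simp add: pos_divide_le_eq mult_ac)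
      then have "C * E \<le> \<delta> * r powr (\<eta> / 4) * E" using E by (rule mult_right_mono)
      also have "\<dots> = \<delta> * (E * r powr (\<eta> / 4))" by simp
      also have "\<dots> \<le> \<delta> * r powr (q - 2)" using E1 \<delta> by (intro mult_left_mono) auto
      finally show ?thesis .
    qed
    finally show ?thesis by simp
  qed
  show thesis
  proof (rule that[of q m R])
    show "0 \<le> q" "0 \<le> m" "m \<le> 2/3" "1 \<le> R" using qm by (auto simp: R_def)
    show "expectation (\<lambda>\<omega>. barrier q m \<rho> (z + \<xi> \<omega>) * indicator A \<omega>) \<le> barrier q m \<rho> z - 2 / (81 * \<rho>\<^sup>2)"
      if "z \<in> wedge" "R \<le> cmod z" "cmod z powr (2/3) \<le> \<rho>" "A \<in> events" for z \<rho> A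
      using drift[OF that] .
    show "integrable M (\<lambda>\<omega>. barrier q m \<rho> (z + \<xi> \<omega>))" if "z \<in> wedge" "R \<le> cmod z" for z \<rho>
      using that by (intro int_bar) (auto simp: R_def)
  qed
qed

end

section \<open>Greedy selection of an increasing subsequence\<close>

text \<open>A state consists of the displacement since the last selected time and the number of times selected
after time \<open>0\<close>. A time is selected as soon as the displacement is nonnegative in every coordinate; the
displacement then restarts from \<open>0\<close>.\<close>

fun greedy_step :: "(int ^ 'd) \<times> nat \<Rightarrow> int ^ 'd \<Rightarrow> (int ^ 'd) \<times> nat" where
  "greedy_step (d, c) x = (if 0 \<le> d + x then (0, Suc c) else (d + x, c))"

primrec greedy :: "(nat \<Rightarrow> int ^ 'd) \<Rightarrow> nat \<Rightarrow> (int ^ 'd) \<times> nat" where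
  "greedy x 0 = (0, 0)"
| "greedy x (Suc n) = greedy_step (greedy x n) (x (Suc n))"

lemma fst_greedy: "\<not> 0 \<le> fst (greedy x n) \<or> fst (greedy x n) = 0"
proof (cases n)
  case (Suc j)
  then show ?thesis by (cases "greedy x j") auto
qed simp

lemma random_walk_Suc: "random_walk X \<omega> (Suc n) = random_walk X \<omega> n + X (Suc n) \<omega>"
  by (simp add: random_walk_def)

lemma real_vec_mono: "v \<le> w \<Longrightarrow> real_vec v \<le> real_vec w"
  by (simp add: less_eq_vec_def real_vec_def)

text \<open>Here \<open>A\<close> is the set of selected times and \<open>l\<close> the last of them. Adding a time preserves monotonicity
because the new position dominates the one at \<open>l\<close>, which dominates all earlier selected ones.\<close>

lemma increasing_set_of_greedy:
  fixes X :: "nat \<Rightarrow> 'a \<Rightarrow> int ^ 'd"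
  shows "\<exists>A l. A \<subseteq> {0..n} \<and> l \<in> A \<and> (\<forall>i\<in>A. i \<le> l) \<and> mono_on A (random_walk X \<omega>)
    \<and> card A = Suc (snd (greedy (\<lambda>i. X i \<omega>) n))
    \<and> random_walk X \<omega> n = random_walk X \<omega> l + fst (greedy (\<lambda>i. X i \<omega>) n)"
proof (induction n)
  case 0
  show ?case by (rule exI[of _ "{0}"], rule exI[of _ 0]) (auto simp: mono_on_def)
next
  case (Suc n)
  obtain d c where g: "greedy (\<lambda>i. X i \<omega>) n = (d, c)" by fastforce
  obtain A l where A: "A \<subseteq> {0..n}" "l \<in> A" "\<forall>i\<in>A. i \<le> l" "mono_on A (random_walk X \<omega>)"
    "card A = Suc c" "random_walk X \<omega> n = random_walk X \<omega> l + d"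
    using Suc g by auto
  show ?case
  proof (cases "0 \<le> d + X (Suc n) \<omega>")
    case True
    have fin: "finite A" using A(1) finite_subset by blast
    have notin: "Suc n \<notin> A" using A(1) by auto
    have eq: "random_walk X \<omega> (Suc n) = random_walk X \<omega> l + (d + X (Suc n) \<omega>)"
      using A(6) by (simp add: random_walk_Suc add.assoc)
    have up: "random_walk X \<omega> i \<le> random_walk X \<omega> (Suc n)" if "i \<in> A" for i
    proof -
      have "random_walk X \<omega> i \<le> random_walk X \<omega> l" using A that by (auto simp: mono_on_def)
      then show ?thesis unfolding eq using True by (auto simp: less_eq_vec_def intro: add_increasing2)
    qed
    have "mono_on (insert (Suc n) A) (random_walk X \<omega>)"
      using A(1,4) up by (auto simp: mono_on_def)
    moreover have "card (insert (Suc n) A) = Suc (Suc c)" using fin notin A(5) by simp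
    ultimately show ?thesis
      using A(1) True g
      by (intro exI[of _ "insert (Suc n) A"] exI[of _ "Suc n"]) auto
  next
    case False
    show ?thesis
      by (rule exI[of _ A], rule exI[of _ l]) (use A False g in \<open>auto simp: random_walk_Suc add.assoc\<close>)
  qed
qed

lemma card_le_LIS:
  assumes "A \<subseteq> {0..<n}" "mono_on A S"
  shows "card A \<le> LIS S n"
proof -
  have "finite {card A |A. A \<subseteq> {0..<n} \<and> mono_on A S}"
    by (rule finite_subset[of _ "card ` Pow {0..<n}"]) auto
  then show ?thesis unfolding LIS_def using assms by (intro Max_ge) auto
qed

lemma LIS_le: "LIS S n \<le> n"
proof -
  have "finite {card A |A. A \<subseteq> {0..<n} \<and> mono_on A S}"
    by (rule finite_subset[of _ "card ` Pow {0..<n}"]) auto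
  moreover have "card ({} :: nat set) \<in> {card A |A. A \<subseteq> {0..<n} \<and> mono_on A S}"
    by (rule CollectI, rule exI[of _ "{}"]) (simp add: mono_on_def)
  ultimately show ?thesis unfolding LIS_def
    by (subst Max_le_iff) (auto dest: card_mono[rotated])
qed

lemma greedy_le_LIS:
  fixes X :: "nat \<Rightarrow> 'a \<Rightarrow> int ^ 'd"
  shows "Suc (snd (greedy (\<lambda>i. X i \<omega>) n)) \<le> LIS (\<lambda>k. real_vec (random_walk X \<omega> k)) (Suc n)"
    and "snd (greedy (\<lambda>i. X i \<omega>) n) \<le> LIS (\<lambda>k. real_vec (random_walk X \<omega> k)) n"
proof -
  have *: "Suc (snd (greedy (\<lambda>i. X i \<omega>) n)) \<le> LIS (\<lambda>k. real_vec (random_walk X \<omega> k)) (Suc n)" for n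
  proof -
    obtain A where A: "A \<subseteq> {0..n}" "mono_on A (random_walk X \<omega>)"
      "card A = Suc (snd (greedy (\<lambda>i. X i \<omega>) n))"
      using increasing_set_of_greedy[of n X \<omega>] by blast
    then have "card A \<le> LIS (\<lambda>k. real_vec (random_walk X \<omega> k)) (Suc n)"
      by (intro card_le_LIS) (auto simp: mono_on_def intro!: real_vec_mono)
    then show ?thesis using A by simp
  qed
  show "Suc (snd (greedy (\<lambda>i. X i \<omega>) n)) \<le> LIS (\<lambda>k. real_vec (random_walk X \<omega> k)) (Suc n)" by (rule *)
  show "snd (greedy (\<lambda>i. X i \<omega>) n) \<le> LIS (\<lambda>k. real_vec (random_walk X \<omega> k)) n"
  proof (cases n)
    case (Suc j)
    have "snd (greedy (\<lambda>i. X i \<omega>) n) \<le> Suc (snd (greedy (\<lambda>i. X i \<omega>) j))"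
      unfolding Suc by (cases "greedy (\<lambda>i. X i \<omega>) j") auto
    then show ?thesis using *[of j] Suc by simp
  qed simp
qed

lemma measurable_greedy:
  assumes "\<And>i. 1 \<le> i \<Longrightarrow> i \<le> n \<Longrightarrow> (\<lambda>\<omega>. X \<omega> i) \<in> measurable M (count_space UNIV)"
  shows "(\<lambda>\<omega>. greedy (X \<omega>) n) \<in> measurable M (count_space UNIV)"
  using assms
proof (induction n)
  case (Suc n)
  have "(\<lambda>\<omega>. greedy_step (greedy (X \<omega>) n) (X \<omega> (Suc n))) \<in> measurable M (count_space UNIV)"
  proof (rule measurable_compose_countable[where f = "\<lambda>s \<omega>. greedy_step s (X \<omega> (Suc n))"])
    show "(\<lambda>\<omega>. greedy_step s (X \<omega> (Suc n))) \<in> measurable M (count_space UNIV)" for s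
      by (rule measurable_compose[OF Suc.prems[of "Suc n"]]) auto
    show "(\<lambda>\<omega>. greedy (X \<omega>) n) \<in> measurable M (count_space UNIV)"
      using Suc by simp
  qed
  then show ?case by simp
qed simp

text \<open>The length depends on the path only through the list of its first \<open>n\<close> positions, an element of a
countable type, on which every function is measurable.\<close>

lemma measurable_LIS:
  fixes X :: "nat \<Rightarrow> 'a \<Rightarrow> int ^ 'd"
  assumes X: "\<And>i. 1 \<le> i \<Longrightarrow> X i \<in> measurable M (count_space UNIV)"
  shows "(\<lambda>\<omega>. LIS (\<lambda>k. real_vec (random_walk X \<omega> k)) n) \<in> measurable M (count_space UNIV)"
proof -
  have walk: "(\<lambda>\<omega>. random_walk X \<omega> k) \<in> measurable M (count_space UNIV)" for k
  proof (induction k)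
    case 0
    then show ?case by (simp add: random_walk_def)
  next
    case (Suc k)
    have "(\<lambda>\<omega>. random_walk X \<omega> k + X (Suc k) \<omega>) \<in> measurable M (count_space UNIV)"
      by (rule measurable_compose_countable[OF _ Suc], rule measurable_compose[OF X]) auto
    then show ?case by (simp add: random_walk_Suc)
  qed
  have path: "(\<lambda>\<omega>. map (random_walk X \<omega>) [0..<n]) \<in> measurable M (count_space UNIV)" for n
  proof (induction n)
    case (Suc n)
    have "(\<lambda>\<omega>. map (random_walk X \<omega>) [0..<n] @ [random_walk X \<omega> n]) \<in> measurable M (count_space UNIV)"
      by (rule measurable_compose_countable[OF _ Suc], rule measurable_compose[OF walk]) auto
    then show ?case by simp
  qed simp
  have "LIS (\<lambda>k. real_vec (random_walk X \<omega> k)) n =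
      LIS (\<lambda>k. real_vec (map (random_walk X \<omega>) [0..<n] ! k)) n" for \<omega>
  proof -
    have "mono_on A (\<lambda>k. real_vec (random_walk X \<omega> k)) \<longleftrightarrow>
        mono_on A (\<lambda>k. real_vec (map (random_walk X \<omega>) [0..<n] ! k))" if "A \<subseteq> {0..<n}" for A
      using that by (auto simp: mono_on_def subset_iff)
    then show ?thesis unfolding LIS_def by (metis (no_types, lifting))
  qed
  then show ?thesis using measurable_compose[OF path[of n], of "\<lambda>l. LIS (\<lambda>k. real_vec (l ! k)) n"] by simp
qed

section \<open>The number of greedy selections\<close>

text \<open>On the displacements that the greedy selection can reach (those outside the quadrant, and \<open>0\<close>), \<open>\<Phi> d\<close>
bounds the mean time, truncated at \<open>n\<close>, until the next selection: as long as \<open>\<Phi> d\<close> is below the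
trivial bound \<open>n\<close>, one step of the walk killed on entering the quadrant lowers the mean of \<open>\<Phi>\<close> by at
least \<open>1\<close>.\<close>

definition level_potential :: "'a measure \<Rightarrow> ('a \<Rightarrow> int ^ 'd) \<Rightarrow> nat \<Rightarrow> (int ^ 'd \<Rightarrow> real) \<Rightarrow> bool" where
  "level_potential M Y n \<Phi> \<longleftrightarrow> (\<forall>d. \<not> 0 \<le> d \<or> d = 0 \<longrightarrow> 0 \<le> \<Phi> d \<and>
     (\<Phi> d < real n \<longrightarrow> integrable M (\<lambda>\<omega>. \<Phi> (d + Y \<omega>)) \<and>
       integral\<^sup>L M (\<lambda>\<omega>. \<Phi> (d + Y \<omega>) * indicator {\<omega> \<in> space M. \<not> 0 \<le> d + Y \<omega>} \<omega>) \<le> \<Phi> d - 1))"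

context prob_space
begin

lemma expectation_indep_countable:
  fixes Y W :: "'a \<Rightarrow> 'b::countable" and f :: "'b \<Rightarrow> 'b \<Rightarrow> real"
  assumes indep: "indep_var (count_space UNIV) Y (count_space UNIV) W"
    and bounded: "\<And>y w. \<bar>f y w\<bar> \<le> B"
  shows "expectation (\<lambda>\<omega>. f (Y \<omega>) (W \<omega>)) = expectation (\<lambda>\<omega>. expectation (\<lambda>\<omega>'. f (Y \<omega>) (W \<omega>')))"
proof -
  let ?cY = "count_space UNIV :: 'b measure" and ?cW = "count_space UNIV :: 'b measure"
  have Y[measurable]: "Y \<in> measurable M ?cY" and W[measurable]: "W \<in> measurable M ?cW"
    using indep_var_rv1[OF indep] indep_var_rv2[OF indep] by auto
  have eq: "distr M ?cY Y \<Otimes>\<^sub>M distr M ?cW W = distr M (?cY \<Otimes>\<^sub>M ?cW) (\<lambda>x. (Y x, W x))"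
    using indep by (simp add: indep_var_distribution_eq)
  interpret Y: prob_space "distr M ?cY Y" by (rule prob_space_distr[OF Y])
  interpret W: prob_space "distr M ?cW W" by (rule prob_space_distr[OF W])
  interpret YW: pair_prob_space "distr M ?cY Y" "distr M ?cW W" ..
  have cc: "?cY \<Otimes>\<^sub>M ?cW = count_space UNIV" by (simp add: pair_measure_countable)
  have meas: "(\<lambda>p. f (fst p) (snd p)) \<in> borel_measurable (?cY \<Otimes>\<^sub>M ?cW)" unfolding cc by simp
  have meas': "(\<lambda>p. f (fst p) (snd p)) \<in> borel_measurable (distr M ?cY Y \<Otimes>\<^sub>M distr M ?cW W)"
    using meas by (simp cong: measurable_cong_sets)
  have int: "integrable (distr M ?cY Y \<Otimes>\<^sub>M distr M ?cW W) (\<lambda>p. f (fst p) (snd p))"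
    by (rule YW.P.integrable_const_bound[of _ B]) (use bounded meas' in auto)
  have "expectation (\<lambda>\<omega>. f (Y \<omega>) (W \<omega>)) = integral\<^sup>L (distr M (?cY \<Otimes>\<^sub>M ?cW) (\<lambda>x. (Y x, W x))) (\<lambda>p. f (fst p) (snd p))"
    by (subst integral_distr[OF _ meas]) auto
  also have "\<dots> = (\<integral>y. (\<integral>w. f y w \<partial>distr M ?cW W) \<partial>distr M ?cY Y)"
    unfolding eq[symmetric] using YW.integral_fst'[OF int] by simp
  also have "\<dots> = (\<integral>y. expectation (\<lambda>\<omega>'. f y (W \<omega>')) \<partial>distr M ?cY Y)"
    by (subst integral_distr[OF W]) auto
  also have "\<dots> = expectation (\<lambda>\<omega>. expectation (\<lambda>\<omega>'. f (Y \<omega>) (W \<omega>')))"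
    by (subst integral_distr[OF Y]) auto
  finally show ?thesis .
qed

text \<open>The Markov property: the state at time \<open>j\<close> is a function of the first \<open>j\<close> increments, hence
independent of the next one, which has the law of \<open>X 1\<close>.\<close>

lemma expectation_greedy_Suc:
  fixes X :: "nat \<Rightarrow> 'a \<Rightarrow> int ^ 'd" and g :: "(int ^ 'd) \<times> nat \<Rightarrow> real"
  assumes indep: "indep_vars (\<lambda>_. count_space UNIV) X {1..}"
    and ident: "\<And>i. i \<ge> 1 \<Longrightarrow> distr M (count_space UNIV) (X i) = distr M (count_space UNIV) (X 1)"
    and bounded: "\<And>s. \<bar>g s\<bar> \<le> B"
  shows "expectation (\<lambda>\<omega>. g (greedy (\<lambda>i. X i \<omega>) (Suc j))) =
    expectation (\<lambda>\<omega>. expectation (\<lambda>\<omega>'. g (greedy_step (greedy (\<lambda>i. X i \<omega>) j) (X 1 \<omega>'))))"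
proof -
  have X: "X i \<in> measurable M (count_space UNIV)" if "1 \<le> i" for i
    using indep that by (auto simp: indep_vars_def)
  have "indep_var (PiM {1..j} (\<lambda>_. count_space UNIV)) (\<lambda>\<omega>. restrict (\<lambda>i. X i \<omega>) {1..j})
      (PiM {Suc j} (\<lambda>_. count_space UNIV)) (\<lambda>\<omega>. restrict (\<lambda>i. X i \<omega>) {Suc j})"
    using indep by (rule indep_var_restrict) auto
  \<comment> \<open>The two members of an independent pair have a common type, so the increment is padded to a state.\<close>
  then have "indep_var (count_space UNIV) ((\<lambda>x. greedy x j) \<circ> (\<lambda>\<omega>. restrict (\<lambda>i. X i \<omega>) {1..j}))
      (count_space UNIV) ((\<lambda>x. (x (Suc j), 0)) \<circ> (\<lambda>\<omega>. restrict (\<lambda>i. X i \<omega>) {Suc j}))"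
    by (rule indep_var_compose) (auto intro!: measurable_greedy)
  moreover have "greedy (restrict (\<lambda>i. X i \<omega>) {1..j}) k = greedy (\<lambda>i. X i \<omega>) k" if "k \<le> j" for \<omega> k
    using that by (induction k) auto
  ultimately have ind: "indep_var (count_space UNIV) (\<lambda>\<omega>. greedy (\<lambda>i. X i \<omega>) j) (count_space UNIV) (\<lambda>\<omega>. (X (Suc j) \<omega>, 0))"
    by (simp add: comp_def)
  have same: "expectation (\<lambda>\<omega>'. h (X (Suc j) \<omega>')) = expectation (\<lambda>\<omega>'. h (X 1 \<omega>'))" for h :: "int ^ 'd \<Rightarrow> real"
  proof -
    have "expectation (\<lambda>\<omega>'. h (X (Suc j) \<omega>')) = integral\<^sup>L (distr M (count_space UNIV) (X (Suc j))) h"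
      by (subst integral_distr[OF X]) auto
    also have "\<dots> = integral\<^sup>L (distr M (count_space UNIV) (X 1)) h" using ident[of "Suc j"] by simp
    also have "\<dots> = expectation (\<lambda>\<omega>'. h (X 1 \<omega>'))"
      by (subst integral_distr[OF X]) auto
    finally show ?thesis .
  qed
  have "expectation (\<lambda>\<omega>. g (greedy_step (greedy (\<lambda>i. X i \<omega>) j) (X (Suc j) \<omega>))) =
      expectation (\<lambda>\<omega>. expectation (\<lambda>\<omega>'. g (greedy_step (greedy (\<lambda>i. X i \<omega>) j) (X (Suc j) \<omega>'))))"
    using expectation_indep_countable[OF ind, of "\<lambda>s x. g (greedy_step s (fst x))" B] bounded by simp
  moreover have "expectation (\<lambda>\<omega>'. g (greedy_step s (X (Suc j) \<omega>'))) =
      expectation (\<lambda>\<omega>'. g (greedy_step s (X 1 \<omega>')))" for s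
    using same[of "\<lambda>x. g (greedy_step s x)"] .
  ultimately show ?thesis unfolding greedy.simps by simp
qed

text \<open>The time until \<open>k\<close> selections, truncated at \<open>n\<close>, has mean at most \<open>k \<Phi>(0)\<close>, because every selection
restarts the displacement from \<open>0\<close>; Markov's inequality gives the claim. In place of stopping times
the proof carries along \<open>g j\<close>, a bound at time \<open>j\<close> for the conditional mean of this truncated time, and
shows that its expectation decreases in \<open>j\<close>.\<close>

lemma greedy_count_tail:
  fixes X :: "nat \<Rightarrow> 'a \<Rightarrow> int ^ 'd" and \<Phi> :: "int ^ 'd \<Rightarrow> real"
  assumes indep: "indep_vars (\<lambda>_. count_space UNIV) X {1..}"
    and ident: "\<And>i. i \<ge> 1 \<Longrightarrow> distr M (count_space UNIV) (X i) = distr M (count_space UNIV) (X 1)"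
    and potential: "level_potential M (X 1) n \<Phi>"
  shows "real n * prob {\<omega> \<in> space M. snd (greedy (\<lambda>i. X i \<omega>) n) < k} \<le> real k * \<Phi> 0"
proof -
  have nonneg: "0 \<le> \<Phi> d" if "\<not> 0 \<le> d \<or> d = 0" for d
    using potential that by (auto simp: level_potential_def)
  have drift: "integrable M (\<lambda>\<omega>. \<Phi> (d + X 1 \<omega>)) \<and>
      expectation (\<lambda>\<omega>. \<Phi> (d + X 1 \<omega>) * indicator {\<omega> \<in> space M. \<not> 0 \<le> d + X 1 \<omega>} \<omega>) \<le> \<Phi> d - 1"
    if "\<not> 0 \<le> d \<or> d = 0" "\<Phi> d < real n" for d
    using potential that by (simp add: level_potential_def)
  define Z where "Z j \<omega> = greedy (\<lambda>i. X i \<omega>) j" for j \<omega>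
  define g where "g j s = (if snd s < k \<and> (\<not> 0 \<le> fst s \<or> fst s = 0)
      then min (real n) (real j + \<Phi> (fst s) + real (k - snd s - 1) * \<Phi> 0) else 0)" for j s
  have X: "X i \<in> measurable M (count_space UNIV)" if "1 \<le> i" for i
    using indep that by (auto simp: indep_vars_def)
  have X1[measurable]: "X 1 \<in> measurable M (count_space UNIV)" by (rule X) simp
  have Z[measurable]: "Z j \<in> measurable M (count_space UNIV)" for j
    unfolding Z_def by (rule measurable_greedy) (rule X)
  have \<Phi>0: "0 \<le> \<Phi> 0" by (rule nonneg) simp
  have g_range: "0 \<le> g j s" "g j s \<le> real n" for j s
    using nonneg[of "fst s"] \<Phi>0 by (auto simp: g_def)
  then have g_abs: "\<bar>g j s\<bar> \<le> real n" for j s by (simp add: abs_le_iff order_trans[of _ 0])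
  have g_int: "integrable M (\<lambda>\<omega>. g j (h \<omega>))" if "h \<in> measurable M (count_space UNIV)" for j h
  proof (rule integrable_const_bound[of _ "real n"])
    show "AE \<omega> in M. norm (g j (h \<omega>)) \<le> real n" using g_abs by simp
    show "(\<lambda>\<omega>. g j (h \<omega>)) \<in> borel_measurable M" by (rule measurable_compose[OF that]) simp
  qed
  have step_meas: "(\<lambda>\<omega>'. greedy_step s (X 1 \<omega>')) \<in> measurable M (count_space UNIV)" for s
    by (rule measurable_compose[OF X1]) simp
  have step: "expectation (\<lambda>\<omega>'. g (Suc j) (greedy_step s (X 1 \<omega>'))) \<le> g j s"
    if s: "\<not> 0 \<le> fst s \<or> fst s = 0" for j s
  proof -
    obtain d c where dc: "s = (d, c)" by fastforce
    show ?thesis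
    proof (cases "c < k")
      case False
      then have "g (Suc j) (greedy_step s x) = 0" for x by (simp add: dc g_def)
      then show ?thesis using g_range by simp
    next
      case c: True
      define b where "b = real j + real (k - c - 1) * \<Phi> 0"
      have gs: "g j s = min (real n) (b + \<Phi> d)" using s c by (simp add: g_def dc b_def)
      \<comment> \<open>Either the truncation is active and \<open>n\<close> is the trivial bound, or \<open>\<Phi> d\<close> is small enough for the drift.\<close>
      show ?thesis
      proof (cases "real n \<le> b + \<Phi> d")
        case True
        have "expectation (\<lambda>\<omega>'. g (Suc j) (greedy_step s (X 1 \<omega>'))) \<le> expectation (\<lambda>_. real n)"
          by (intro integral_mono g_int step_meas g_range) simp
        then show ?thesis using True gs by (simp add: prob_space)
      next
        case False
        have "0 \<le> b" using \<Phi>0 by (simp add: b_def)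
        then have small: "\<Phi> d < real n" using False by linarith
        define A where "A = {\<omega> \<in> space M. \<not> 0 \<le> d + X 1 \<omega>}"
        have A: "A \<in> events" unfolding A_def
          using measurable_sets[OF X1, of "{x. \<not> 0 \<le> d + x}"] by (simp add: vimage_def Int_def conj_commute)
        have int: "integrable M (\<lambda>\<omega>. \<Phi> (d + X 1 \<omega>) * indicator A \<omega>)"
          using drift[of d] s small A by (intro integrable_real_mult_indicator) (auto simp: dc)
        have "expectation (\<lambda>\<omega>'. g (Suc j) (greedy_step s (X 1 \<omega>')))
            \<le> expectation (\<lambda>\<omega>. (b + 1) + \<Phi> (d + X 1 \<omega>) * indicator A \<omega>)"
        proof (rule integral_mono)
          fix \<omega> assume \<omega>: "\<omega> \<in> space M"
          show "g (Suc j) (greedy_step s (X 1 \<omega>)) \<le> (b + 1) + \<Phi> (d + X 1 \<omega>) * indicator A \<omega>"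
          proof (cases "0 \<le> d + X 1 \<omega>")
            case True
            then have eq: "g (Suc j) (greedy_step s (X 1 \<omega>)) = (if Suc c < k then
                min (real n) (real (Suc j) + \<Phi> 0 + real (k - Suc c - 1) * \<Phi> 0) else 0)"
              by (simp add: dc g_def)
            have "g (Suc j) (greedy_step s (X 1 \<omega>)) \<le> b + 1"
            proof (cases "Suc c < k")
              case True
              then have "real (k - c - 1) = real (k - Suc c - 1) + 1" by simp
              then have "real (k - c - 1) * \<Phi> 0 = \<Phi> 0 + real (k - Suc c - 1) * \<Phi> 0"
                by (simp only: distrib_right mult_1_left add.commute)
              then show ?thesis using True unfolding eq b_def by simp
            next
              case False
              then show ?thesis using \<open>0 \<le> b\<close> unfolding eq by simp
            qed
            then show ?thesis using True by (simp add: A_def)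
          next
            case False
            then show ?thesis using \<omega> c by (simp add: dc g_def A_def b_def)
          qed
        qed (use int g_int[OF step_meas] in auto)
        also have "\<dots> = b + 1 + expectation (\<lambda>\<omega>. \<Phi> (d + X 1 \<omega>) * indicator A \<omega>)"
          using int by (simp add: prob_space)
        also have "\<dots> \<le> b + \<Phi> d"
          using drift[of d] s small unfolding A_def by (auto simp: dc)
        finally show ?thesis using False gs by simp
      qed
    qed
  qed
  have dec: "expectation (\<lambda>\<omega>. g j (Z j \<omega>)) \<le> real k * \<Phi> 0" for j
  proof (induction j)
    case 0
    have "g 0 (Z 0 \<omega>) \<le> real k * \<Phi> 0" for \<omega>
    proof (cases "k = 0")
      case False
      then have "real k * \<Phi> 0 = \<Phi> 0 + real (k - 1) * \<Phi> 0"
        by (cases k) (simp_all add: algebra_simps)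
      then show ?thesis using False by (simp add: g_def Z_def)
    qed (simp add: g_def)
    then have "expectation (\<lambda>\<omega>. g 0 (Z 0 \<omega>)) \<le> expectation (\<lambda>_. real k * \<Phi> 0)"
      by (intro integral_mono g_int Z) auto
    then show ?case by (simp add: prob_space)
  next
    case (Suc j)
    have "expectation (\<lambda>\<omega>. g (Suc j) (Z (Suc j) \<omega>)) =
      expectation (\<lambda>\<omega>. expectation (\<lambda>\<omega>'. g (Suc j) (greedy_step (Z j \<omega>) (X 1 \<omega>'))))"
      unfolding Z_def by (rule expectation_greedy_Suc[OF indep ident g_abs])
    also have "\<dots> \<le> expectation (\<lambda>\<omega>. g j (Z j \<omega>))"
    proof (rule integral_mono)
      show "integrable M (\<lambda>\<omega>. expectation (\<lambda>\<omega>'. g (Suc j) (greedy_step (Z j \<omega>) (X 1 \<omega>'))))"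
      proof (rule integrable_const_bound[of _ "real n"])
        have "\<bar>expectation (\<lambda>\<omega>'. g (Suc j) (greedy_step s (X 1 \<omega>')))\<bar> \<le> real n" for s
        proof -
          have "expectation (\<lambda>\<omega>'. g (Suc j) (greedy_step s (X 1 \<omega>'))) \<le> expectation (\<lambda>_. real n)"
            by (intro integral_mono g_int step_meas g_range) simp
          moreover have "0 \<le> expectation (\<lambda>\<omega>'. g (Suc j) (greedy_step s (X 1 \<omega>')))"
            using g_range by (intro Bochner_Integration.integral_nonneg) auto
          ultimately show ?thesis by (simp add: prob_space)
        qed
        then show "AE \<omega> in M. norm (expectation (\<lambda>\<omega>'. g (Suc j) (greedy_step (Z j \<omega>) (X 1 \<omega>')))) \<le> real n"
          by simp
        show "(\<lambda>\<omega>. expectation (\<lambda>\<omega>'. g (Suc j) (greedy_step (Z j \<omega>) (X 1 \<omega>')))) \<in> borel_measurable M"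
          by (rule measurable_compose[OF Z]) simp
      qed
      show "expectation (\<lambda>\<omega>'. g (Suc j) (greedy_step (Z j \<omega>) (X 1 \<omega>'))) \<le> g j (Z j \<omega>)" for \<omega>
        by (rule step) (unfold Z_def, rule fst_greedy)
    qed (rule g_int[OF Z])
    finally show ?case using Suc by linarith
  qed
  define B where "B = {\<omega> \<in> space M. snd (Z n \<omega>) < k}"
  have B: "B \<in> events" unfolding B_def
    using measurable_sets[OF Z[of n], of "{s. snd s < k}"] by (simp add: vimage_def Int_def conj_commute)
  have "real n * prob B = expectation (\<lambda>\<omega>. real n * indicator B \<omega>)" using B by simp
  also have "\<dots> \<le> expectation (\<lambda>\<omega>. g n (Z n \<omega>))"
  proof (rule integral_mono)
    show "real n * indicator B \<omega> \<le> g n (Z n \<omega>)" for \<omega>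
    proof (cases "\<omega> \<in> B")
      case True
      then have "g n (Z n \<omega>) = min (real n) (real n + \<Phi> (fst (Z n \<omega>)) + real (k - snd (Z n \<omega>) - 1) * \<Phi> 0)"
        using fst_greedy[of "\<lambda>i. X i \<omega>" n] by (simp add: g_def B_def Z_def)
      also have "\<dots> = real n"
        using nonneg[OF fst_greedy[of "\<lambda>i. X i \<omega>" n]] \<Phi>0 by (simp add: Z_def)
      finally show ?thesis using True by simp
    qed (use g_range in simp)
  qed (use B g_int[OF Z] in \<open>auto simp: emeasure_eq_measure\<close>)
  also have "\<dots> \<le> real k * \<Phi> 0" by (rule dec)
  finally show ?thesis unfolding B_def Z_def .
qed

end

section \<open>Planar walks with identity covariance\<close>

text \<open>Multiplication by \<open>-1 + \<i>\<close>: it maps the direction of \<open>(-1, -1)\<close>, the axis of the complement of the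
positive quadrant, to the positive real axis, and keeps integer coordinates.\<close>

definition diag_coords :: "int ^ 2 \<Rightarrow> complex" where
  "diag_coords v = Complex (- of_int (v $ 1) - of_int (v $ 2)) (of_int (v $ 1) - of_int (v $ 2))"

lemma diag_coords_add: "diag_coords (v + w) = diag_coords v + diag_coords w"
  by (simp add: diag_coords_def complex_eq_iff)

lemma diag_coords_0 [simp]: "diag_coords 0 = 0"
  by (simp add: diag_coords_def complex_eq_iff)

text \<open>The apex of the wedge is moved into the quadrant. All displacements of interest then lie in the wedge
at distance at least \<open>R\<close> from the apex, so the small radii, where expansions fail, never occur.\<close>

lemma shifted_diag_coords_wedge:
  fixes d :: "int ^ 2"
  assumes "\<not> 0 \<le> d \<or> d = 0" and R: "0 \<le> R"
  shows "of_real (2 * R) + diag_coords d \<in> wedge" "R \<le> cmod (of_real (2 * R) + diag_coords d)"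
proof -
  define z where "z = of_real (2 * R) + diag_coords d"
  have "d $ 1 \<le> 0 \<or> d $ 2 \<le> 0"
    using assms(1) by (auto simp: less_eq_vec_def forall_2)
  then have "real_of_int (d $ 1) \<le> 0 \<or> real_of_int (d $ 2) \<le> 0" by simp
  then have *: "2 * R \<le> Re z + \<bar>Im z\<bar>" by (auto simp: z_def diag_coords_def)
  then show "z \<in> wedge" using R by (simp add: wedge_def)
  show "R \<le> cmod z" using * abs_Re_le_cmod[of z] abs_Im_le_cmod[of z] by linarith
qed

lemma (in prob_space) isotropic_step_diag_coords:
  fixes X :: "'a \<Rightarrow> int ^ 2"
  assumes X: "X \<in> measurable M (count_space UNIV)"
    and mean: "expectation (\<lambda>\<omega>. real_vec (X \<omega>)) = 0"
    and cov: "covariance_matrix M (\<lambda>\<omega>. real_vec (X \<omega>)) = mat 1"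
    and \<eta>: "\<eta> > 0"
    and moments: "\<And>j. integrable M (\<lambda>\<omega>. \<bar>real_vec (X \<omega>) $ j\<bar> powr (2 + \<eta>))"
  shows "isotropic_step M (\<lambda>\<omega>. diag_coords (X \<omega>)) (min \<eta> 1)"
proof -
  define Y where "Y j \<omega> = real_of_int (X \<omega> $ j)" for j \<omega>
  have Yeq: "real_vec (X \<omega>) $ j = Y j \<omega>" for j \<omega> by (simp add: real_vec_def Y_def)
  have Ym[measurable]: "Y j \<in> borel_measurable M" for j
    unfolding Y_def by (rule measurable_compose[OF X]) simp
  have mom: "integrable M (\<lambda>\<omega>. \<bar>Y j \<omega>\<bar> powr a)" if a: "0 \<le> a" "a \<le> 2 + \<eta>" for a j
  proof (rule Bochner_Integration.integrable_bound)
    show "integrable M (\<lambda>\<omega>. 1 + \<bar>Y j \<omega>\<bar> powr (2 + \<eta>))" using moments[of j] by (simp add: Yeq)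
    show "AE \<omega> in M. norm (\<bar>Y j \<omega>\<bar> powr a) \<le> norm (1 + \<bar>Y j \<omega>\<bar> powr (2 + \<eta>))"
    proof (rule AE_I2)
      fix \<omega>
      show "norm (\<bar>Y j \<omega>\<bar> powr a) \<le> norm (1 + \<bar>Y j \<omega>\<bar> powr (2 + \<eta>))"
      proof (cases "\<bar>Y j \<omega>\<bar> \<le> 1")
        case True
        then have "\<bar>Y j \<omega>\<bar> powr a \<le> 1 powr a" using a by (intro powr_mono2) auto
        then show ?thesis by (simp add: add_increasing2)
      next
        case False
        then have "\<bar>Y j \<omega>\<bar> powr a \<le> \<bar>Y j \<omega>\<bar> powr (2 + \<eta>)" using a by (intro powr_mono) auto
        then show ?thesis by simp
      qed
    qed
  qed measurable
  have int1: "integrable M (Y j)" for j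
    using mom[of 1 j] \<eta> by (simp add: integrable_abs_iff)
  have int2: "integrable M (\<lambda>\<omega>. (Y j \<omega>)\<^sup>2)" for j
  proof -
    have "\<bar>y\<bar> powr 2 = y\<^sup>2" for y :: real
      by (cases "y = 0") (simp_all add: powr_numeral)
    then show ?thesis using mom[of 2 j] \<eta> by simp
  qed
  have int12: "integrable M (\<lambda>\<omega>. Y 1 \<omega> * Y 2 \<omega>)"
  proof (rule Bochner_Integration.integrable_bound)
    show "integrable M (\<lambda>\<omega>. (Y 1 \<omega>)\<^sup>2 + (Y 2 \<omega>)\<^sup>2)" using int2 by simp
    show "AE \<omega> in M. norm (Y 1 \<omega> * Y 2 \<omega>) \<le> norm ((Y 1 \<omega>)\<^sup>2 + (Y 2 \<omega>)\<^sup>2)"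
    proof (rule AE_I2)
      fix \<omega>
      have "2 * \<bar>Y 1 \<omega>\<bar> * \<bar>Y 2 \<omega>\<bar> \<le> \<bar>Y 1 \<omega>\<bar>\<^sup>2 + \<bar>Y 2 \<omega>\<bar>\<^sup>2" by (rule sum_squares_bound)
      moreover have "0 \<le> \<bar>Y 1 \<omega>\<bar> * \<bar>Y 2 \<omega>\<bar>" by simp
      ultimately have "\<bar>Y 1 \<omega>\<bar> * \<bar>Y 2 \<omega>\<bar> \<le> \<bar>Y 1 \<omega>\<bar>\<^sup>2 + \<bar>Y 2 \<omega>\<bar>\<^sup>2" by linarith
      then show "norm (Y 1 \<omega> * Y 2 \<omega>) \<le> norm ((Y 1 \<omega>)\<^sup>2 + (Y 2 \<omega>)\<^sup>2)"
        by (simp add: abs_mult)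
    qed
  qed measurable
  have int_vec: "integrable M (\<lambda>\<omega>. real_vec (X \<omega>))"
  proof (rule Bochner_Integration.integrable_bound)
    show "integrable M (\<lambda>\<omega>. \<bar>Y 1 \<omega>\<bar> + \<bar>Y 2 \<omega>\<bar>)" using int1 by simp
    show "(\<lambda>\<omega>. real_vec (X \<omega>)) \<in> borel_measurable M"
      by (rule measurable_compose[OF X]) simp
    show "AE \<omega> in M. norm (real_vec (X \<omega>)) \<le> norm (\<bar>Y 1 \<omega>\<bar> + \<bar>Y 2 \<omega>\<bar>)"
      using norm_le_l1_cart[of "real_vec (X _)"] by (simp add: sum_2 Yeq)
  qed
  have mean_Y: "expectation (Y j) = 0" for j
  proof -
    have "expectation (\<lambda>\<omega>. real_vec (X \<omega>) $ j) = expectation (\<lambda>\<omega>. real_vec (X \<omega>)) $ j"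
      by (rule integral_bounded_linear[OF bounded_linear_vec_nth int_vec])
    then show ?thesis using mean by (simp add: Yeq)
  qed
  have "covariance_matrix M (\<lambda>\<omega>. real_vec (X \<omega>)) $ i $ j = expectation (\<lambda>\<omega>. Y i \<omega> * Y j \<omega>)" for i j
    by (simp add: covariance_matrix_def Yeq mean_Y)
  then have cov_Y: "expectation (\<lambda>\<omega>. Y i \<omega> * Y j \<omega>) = (if i = j then 1 else 0)" for i j
    using cov by (simp add: mat_def)
  have v1: "expectation (\<lambda>\<omega>. (Y j \<omega>)\<^sup>2) = 1" for j using cov_Y[of j j] by (simp add: power2_eq_square)
  have c12: "expectation (\<lambda>\<omega>. Y 1 \<omega> * Y 2 \<omega>) = 0" using cov_Y[of 1 2] by simp
  have rot: "diag_coords (X \<omega>) = of_real (- Y 1 \<omega> - Y 2 \<omega>) + \<i> * of_real (Y 1 \<omega> - Y 2 \<omega>)" for \<omega>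
    by (simp add: diag_coords_def Y_def complex_eq_iff)
  show ?thesis
  proof
    show meas: "(\<lambda>\<omega>. diag_coords (X \<omega>)) \<in> borel_measurable M"
      by (rule measurable_compose[OF X]) simp
    show "0 < min \<eta> 1" "min \<eta> 1 \<le> 1" using \<eta> by auto
    define a where "a = 2 + min \<eta> 1"
    have a: "0 \<le> a" "a \<le> 2 + \<eta>" using \<eta> by (auto simp: a_def)
    show "integrable M (\<lambda>\<omega>. cmod (diag_coords (X \<omega>)) powr (2 + min \<eta> 1))"
      unfolding a_def[symmetric]
    proof (rule Bochner_Integration.integrable_bound)
      show "integrable M (\<lambda>\<omega>. 4 powr a * (\<bar>Y 1 \<omega>\<bar> powr a + \<bar>Y 2 \<omega>\<bar> powr a))"
        using mom[OF a] by simp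
      show "(\<lambda>\<omega>. cmod (diag_coords (X \<omega>)) powr a) \<in> borel_measurable M" using meas by measurable
      show "AE \<omega> in M. norm (cmod (diag_coords (X \<omega>)) powr a) \<le> norm (4 powr a * (\<bar>Y 1 \<omega>\<bar> powr a + \<bar>Y 2 \<omega>\<bar> powr a))"
      proof (rule AE_I2)
        fix \<omega>
        have "cmod (diag_coords (X \<omega>)) \<le> \<bar>Re (diag_coords (X \<omega>))\<bar> + \<bar>Im (diag_coords (X \<omega>))\<bar>" by (rule cmod_le)
        also have "\<dots> \<le> 4 * max \<bar>Y 1 \<omega>\<bar> \<bar>Y 2 \<omega>\<bar>" by (simp add: diag_coords_def Y_def)
        finally have "cmod (diag_coords (X \<omega>)) powr a \<le> (4 * max \<bar>Y 1 \<omega>\<bar> \<bar>Y 2 \<omega>\<bar>) powr a"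
          using a by (intro powr_mono2) auto
        also have "\<dots> = 4 powr a * (max \<bar>Y 1 \<omega>\<bar> \<bar>Y 2 \<omega>\<bar>) powr a" by (simp add: powr_mult)
        also have "\<dots> \<le> 4 powr a * (\<bar>Y 1 \<omega>\<bar> powr a + \<bar>Y 2 \<omega>\<bar> powr a)"
          by (intro mult_left_mono) (auto simp: max_def)
        finally show "norm (cmod (diag_coords (X \<omega>)) powr a) \<le> norm (4 powr a * (\<bar>Y 1 \<omega>\<bar> powr a + \<bar>Y 2 \<omega>\<bar> powr a))"
          by simp
      qed
    qed
    show "expectation (\<lambda>\<omega>. diag_coords (X \<omega>)) = 0"
      unfolding rot using int1 mean_Y by (simp del: of_real_add of_real_diff of_real_minus)
    have sq: "(diag_coords (X \<omega>))\<^sup>2 = of_real (4 * (Y 1 \<omega> * Y 2 \<omega>)) + \<i> * of_real (2 * (Y 2 \<omega>)\<^sup>2 - 2 * (Y 1 \<omega>)\<^sup>2)" for \<omega>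
      unfolding rot by (simp add: complex_eq_iff power2_eq_square algebra_simps)
    show "expectation (\<lambda>\<omega>. (diag_coords (X \<omega>))\<^sup>2) = 0"
      unfolding sq using int12 int2 c12 v1 by (simp del: of_real_add of_real_diff of_real_minus of_real_mult)
    have nsq: "(cmod (diag_coords (X \<omega>)))\<^sup>2 = 2 * (Y 1 \<omega>)\<^sup>2 + 2 * (Y 2 \<omega>)\<^sup>2" for \<omega>
      unfolding cmod_power2 diag_coords_def Y_def by (simp add: power2_eq_square algebra_simps)
    show "expectation (\<lambda>\<omega>. (cmod (diag_coords (X \<omega>)))\<^sup>2) = 4"
      unfolding nsq using int2 v1 by simp
  qed
qed

text \<open>The barrier with \<open>\<rho> = n\<^bsup>1/3\<^esup>\<close>, multiplied by \<open>162 \<rho>\<^sup>2\<close> so that its drift is at most \<open>-1\<close>. At the start it is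
of order \<open>\<rho>\<^sup>2 = n\<^bsup>2/3\<^esup>\<close>. Beyond the length scale it exceeds \<open>162 \<rho>\<^sup>2 (\<rho>/162) = n\<close>.\<close>

lemma (in prob_space) quadrant_potential:
  fixes X :: "'a \<Rightarrow> int ^ 2"
  assumes X: "X \<in> measurable M (count_space UNIV)"
    and step: "isotropic_step M (\<lambda>\<omega>. diag_coords (X \<omega>)) \<eta>"
  shows "\<exists>C>0. \<forall>n>0. \<exists>\<Phi>. level_potential M X n \<Phi> \<and> \<Phi> 0 \<le> C * real n powr (2/3)"
proof -
  interpret isotropic_step M "\<lambda>\<omega>. diag_coords (X \<omega>)" \<eta> by (rule step)
  obtain q m R where qm: "0 \<le> q" "0 \<le> m" "m \<le> 2/3" "1 \<le> R"
    and drift: "\<And>z \<rho> A. z \<in> wedge \<Longrightarrow> R \<le> cmod z \<Longrightarrow> cmod z powr (2/3) \<le> \<rho> \<Longrightarrow> A \<in> events \<Longrightarrow>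
      expectation (\<lambda>\<omega>. barrier q m \<rho> (z + diag_coords (X \<omega>)) * indicator A \<omega>) \<le> barrier q m \<rho> z - 2 / (81 * \<rho>\<^sup>2)"
    and int: "\<And>z \<rho>. z \<in> wedge \<Longrightarrow> R \<le> cmod z \<Longrightarrow> integrable M (\<lambda>\<omega>. barrier q m \<rho> (z + diag_coords (X \<omega>)))"
    using barrier_drift by blast
  define C where "C = 162 * ((2 * R) powr (2/3) + (2 * R) powr q + (2 * R)\<^sup>2)"
  show ?thesis
  proof (intro exI[of _ C] conjI allI impI)
    have "0 < (2 * R)\<^sup>2" using qm by simp
    then show "0 < C" unfolding C_def by (intro mult_pos_pos add_nonneg_pos) auto
    fix n :: nat assume n: "0 < n"
    define \<rho> where "\<rho> = real n powr (1/3)"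
    have \<rho>: "1 \<le> \<rho>" using n by (simp add: \<rho>_def ge_one_powr_ge_zero)
    have \<rho>2: "\<rho>\<^sup>2 = real n powr (2/3)" by (simp add: \<rho>_def power2_eq_square powr_add[symmetric])
    have \<rho>3: "\<rho>\<^sup>2 * \<rho> = real n" unfolding \<rho>2 unfolding \<rho>_def using n by (simp add: powr_add[symmetric])
    define pos where "pos d = of_real (2 * R) + diag_coords d" for d
    define \<Phi> where "\<Phi> d = 162 * \<rho>\<^sup>2 * barrier q m \<rho> (pos d)" for d
    have pos: "pos d \<in> wedge" "R \<le> cmod (pos d)" if "\<not> 0 \<le> d \<or> d = 0" for d
      using shifted_diag_coords_wedge[OF that, of R] qm by (auto simp: pos_def)
    have pos_add: "pos (d + X \<omega>) = pos d + diag_coords (X \<omega>)" for d \<omega>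
      by (simp add: pos_def diag_coords_add add.assoc)
    have "0 \<le> \<Phi> d" if "\<not> 0 \<le> d \<or> d = 0" for d
      unfolding \<Phi>_def using pos[OF that] qm \<rho> by (intro mult_nonneg_nonneg barrier_wedge_nonneg) auto
    moreover have "\<Phi> 0 \<le> C * real n powr (2/3)"
    proof -
      have "barrier q m \<rho> (pos 0) \<le> (2 * R) powr (2/3) + (2 * R) powr q + (2 * R)\<^sup>2"
        using barrier_le[OF \<rho>, of q m "pos 0"] qm unfolding pos_def
        by (simp add: norm_mult)
      then have "\<rho>\<^sup>2 * (162 * barrier q m \<rho> (pos 0)) \<le> \<rho>\<^sup>2 * C"
        unfolding C_def by (intro mult_left_mono) auto
      then show ?thesis unfolding \<Phi>_def \<rho>2[symmetric] by (simp add: mult_ac)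
    qed
    moreover have "integrable M (\<lambda>\<omega>. \<Phi> (d + X \<omega>)) \<and>
        expectation (\<lambda>\<omega>. \<Phi> (d + X \<omega>) * indicator {\<omega> \<in> space M. \<not> 0 \<le> d + X \<omega>} \<omega>) \<le> \<Phi> d - 1"
      if d: "\<not> 0 \<le> d \<or> d = 0" "\<Phi> d < real n" for d
    proof
      show "integrable M (\<lambda>\<omega>. \<Phi> (d + X \<omega>))"
        unfolding \<Phi>_def pos_add using int[OF pos[OF d(1)], of \<rho>] by simp
      define A where "A = {\<omega> \<in> space M. \<not> 0 \<le> d + X \<omega>}"
      have A: "A \<in> events" unfolding A_def
        using measurable_sets[OF X, of "{x. \<not> 0 \<le> d + x}"] by (simp add: vimage_def Int_def conj_commute)
      have small: "cmod (pos d) powr (2/3) \<le> \<rho>"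
      proof (rule ccontr)
        assume "\<not> ?thesis"
        then have "\<rho> / 162 \<le> barrier q m \<rho> (pos d)"
          using pos[OF d(1)] qm \<rho> by (intro barrier_wedge_ge) auto
        then have "162 * \<rho>\<^sup>2 * (\<rho> / 162) \<le> \<Phi> d"
          unfolding \<Phi>_def by (intro mult_left_mono) auto
        then show False using d(2) \<rho>3 by simp
      qed
      have "expectation (\<lambda>\<omega>. \<Phi> (d + X \<omega>) * indicator A \<omega>) =
          162 * \<rho>\<^sup>2 * expectation (\<lambda>\<omega>. barrier q m \<rho> (pos d + diag_coords (X \<omega>)) * indicator A \<omega>)"
        unfolding \<Phi>_def pos_add mult.assoc by simp
      also have "\<dots> \<le> 162 * \<rho>\<^sup>2 * (barrier q m \<rho> (pos d) - 2 / (81 * \<rho>\<^sup>2))"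
        using drift[OF pos[OF d(1)] small A] by (intro mult_left_mono) auto
      also have "\<dots> = \<Phi> d - 4" using \<rho> by (simp add: \<Phi>_def right_diff_distrib)
      finally show "expectation (\<lambda>\<omega>. \<Phi> (d + X \<omega>) * indicator {\<omega> \<in> space M. \<not> 0 \<le> d + X \<omega>} \<omega>) \<le> \<Phi> d - 1"
        unfolding A_def by simp
    qed
    ultimately have "level_potential M X n \<Phi> \<and> \<Phi> 0 \<le> C * real n powr (2/3)"
      unfolding level_potential_def by (intro conjI allI impI) auto
    then show "\<exists>\<Phi>. level_potential M X n \<Phi> \<and> \<Phi> 0 \<le> C * real n powr (2/3)"
      by (rule exI[of _ \<Phi>])
  qed
qed

theorem theorem3:
  fixes M :: "'a measure" and X :: "nat \<Rightarrow> 'a \<Rightarrow> int ^ 2" and \<eta> :: real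
  assumes "prob_space M"
    and indep: "prob_space.indep_vars M (\<lambda>_. count_space UNIV) X {1..}"
    and ident: "\<And>i. i \<ge> 1 \<Longrightarrow>
      distr M (count_space UNIV) (X i) = distr M (count_space UNIV) (X 1)"
    and mean: "integral\<^sup>L M (\<lambda>\<omega>. real_vec (X 1 \<omega>)) = 0"
    and cov: "covariance_matrix M (\<lambda>\<omega>. real_vec (X 1 \<omega>)) = mat 1"
    and "\<eta> > 0"
    and moments: "\<And>j. integrable M (\<lambda>\<omega>. \<bar>real_vec (X 1 \<omega>) $ j\<bar> powr (2 + \<eta>))"
  shows "\<exists>c>0.
    (\<forall>\<epsilon>>0. \<forall>n>0.
      measure M {\<omega> \<in> space M.
        real (LIS (\<lambda>k. real_vec (random_walk X \<omega> k)) n) < \<epsilon> * real n powr (1/3)} \<le> c * \<epsilon>) \<and>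
    (\<forall>n>0.
      integral\<^sup>L M (\<lambda>\<omega>. real (LIS (\<lambda>k. real_vec (random_walk X \<omega> k)) n))
        \<ge> 1 / (4 * c) * real n powr (1/3))"
proof -
  interpret prob_space M by fact
  define L where "L n \<omega> = LIS (\<lambda>k. real_vec (random_walk X \<omega> k)) n" for n \<omega>
  have X: "X i \<in> measurable M (count_space UNIV)" if "1 \<le> i" for i
    using indep that by (auto simp: indep_vars_def)
  have L_meas: "L n \<in> measurable M (count_space UNIV)" for n
    unfolding L_def by (rule measurable_LIS) (rule X)
  have X1: "X 1 \<in> measurable M (count_space UNIV)" by (rule X) simp
  obtain C where C: "0 < C" and potential: "\<And>n. 0 < n \<Longrightarrow>
      \<exists>\<Phi>. level_potential M (X 1) n \<Phi> \<and> \<Phi> 0 \<le> C * real n powr (2/3)"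
    using quadrant_potential[OF X1 isotropic_step_diag_coords[OF X1 mean cov \<open>\<eta> > 0\<close> moments]] by blast
  define c where "c = 2 * C"
  have c: "0 < c" using C by (simp add: c_def)
  have tail: "prob {\<omega> \<in> space M. real (L n \<omega>) < \<epsilon> * real n powr (1/3)} \<le> c * \<epsilon>"
    if \<epsilon>: "0 < \<epsilon>" and n: "0 < n" for \<epsilon> n
  proof -
    define x where "x = \<epsilon> * real n powr (1/3)"
    show ?thesis
    proof (cases "x \<le> 1")
      case True
      \<comment> \<open>The threshold is below the trivial bound \<open>1\<close>. Excluding this case allows rounding up at the cost of a factor \<open>2\<close>.\<close>
      have "1 \<le> L n \<omega>" for \<omega>
      proof -
        obtain j where "n = Suc j" using n gr0_implies_Suc by blast
        then show ?thesis using greedy_le_LIS(1)[where X = X and \<omega> = \<omega> and n = j] unfolding L_def by simp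
      qed
      then have "{\<omega> \<in> space M. real (L n \<omega>) < x} = {}" using True by (auto simp: not_less intro: order_trans)
      then show ?thesis using c \<epsilon> unfolding x_def by (simp only: measure_empty) simp
    next
      case False
      obtain \<Phi> where \<Phi>: "level_potential M (X 1) n \<Phi>" "\<Phi> 0 \<le> C * real n powr (2/3)"
        using potential[OF n] by blast
      then have \<Phi>0: "0 \<le> \<Phi> 0" by (simp add: level_potential_def)
      define k where "k = nat \<lceil>x\<rceil>"
      have "real k = of_int \<lceil>x\<rceil>" using False by (simp add: k_def)
      then have k: "x \<le> real k" "real k \<le> 2 * x" using False ceiling_correct[of x] by linarith+
      define B where "B = {\<omega> \<in> space M. snd (greedy (\<lambda>i. X i \<omega>) n) < k}"
      have B: "B \<in> events"
      proof -
        have Z: "(\<lambda>\<omega>. greedy (\<lambda>i. X i \<omega>) n) \<in> measurable M (count_space UNIV)"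
          by (rule measurable_greedy) (rule X)
        show ?thesis unfolding B_def
          using measurable_sets[OF Z, of "{s. snd s < k}"] by (simp add: vimage_def Int_def conj_commute)
      qed
      have "{\<omega> \<in> space M. real (L n \<omega>) < x} \<subseteq> B"
      proof safe
        fix \<omega> assume \<omega>: "\<omega> \<in> space M" "real (L n \<omega>) < x"
        have "snd (greedy (\<lambda>i. X i \<omega>) n) \<le> L n \<omega>" unfolding L_def by (rule greedy_le_LIS(2))
        moreover have "L n \<omega> < k" using \<omega>(2) k(1) by linarith
        ultimately show "\<omega> \<in> B" using \<omega>(1) by (simp add: B_def)
      qed
      then have "prob {\<omega> \<in> space M. real (L n \<omega>) < x} \<le> prob B" by (rule finite_measure_mono) (rule B)
      also have "prob B \<le> c * \<epsilon>"
      proof -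
        have "real n * prob B \<le> real k * \<Phi> 0"
          unfolding B_def by (rule greedy_count_tail[OF indep ident \<Phi>(1)])
        also have "\<dots> \<le> (2 * x) * (C * real n powr (2/3))"
          using k \<Phi>0 \<Phi>(2) False by (intro mult_mono) auto
        also have "\<dots> = c * \<epsilon> * (real n powr (1/3) * real n powr (2/3))" by (simp add: x_def c_def)
        also have "real n powr (1/3) * real n powr (2/3) = real n" using n by (simp add: powr_add[symmetric])
        finally have "prob B * real n \<le> c * \<epsilon> * real n" by (simp add: mult_ac)
        then show ?thesis using n by simp
      qed
      finally show ?thesis unfolding x_def .
    qed
  qed
  have mean_LIS: "1 / (4 * c) * real n powr (1/3) \<le> expectation (\<lambda>\<omega>. real (L n \<omega>))" if n: "0 < n" for n
  proof -
    \<comment> \<open>With \<open>\<epsilon> = 1 / (2 * c)\<close> the tail bound leaves probability at least \<open>1/2\<close> for \<open>LIS \<ge> x\<close>.\<close>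
    define x where "x = 1 / (2 * c) * real n powr (1/3)"
    have x: "0 \<le> x" using c by (simp add: x_def)
    define B where "B = {\<omega> \<in> space M. real (L n \<omega>) < x}"
    have B: "B \<in> events" unfolding B_def
      using measurable_sets[OF L_meas[of n], of "{l. real l < x}"] by (simp add: vimage_def Int_def conj_commute)
    have "prob B \<le> c * (1 / (2 * c))" unfolding B_def x_def using c n by (intro tail) auto
    then have "1/2 \<le> 1 - prob B" using c by simp
    also have "\<dots> = prob (space M - B)" using B by (simp add: prob_compl)
    finally have "x * (1/2) \<le> x * prob (space M - B)" using x by (rule mult_left_mono)
    also have "\<dots> = expectation (\<lambda>\<omega>. x * indicator (space M - B) \<omega>)" using B by simp
    also have "\<dots> \<le> expectation (\<lambda>\<omega>. real (L n \<omega>))"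
    proof (rule integral_mono)
      show "integrable M (\<lambda>\<omega>. real (L n \<omega>))"
      proof (rule integrable_const_bound[of _ "real n"])
        show "AE \<omega> in M. norm (real (L n \<omega>)) \<le> real n" by (intro AE_I2) (simp add: L_def LIS_le)
        show "(\<lambda>\<omega>. real (L n \<omega>)) \<in> borel_measurable M" by (rule measurable_compose[OF L_meas]) simp
      qed
      show "x * indicator (space M - B) \<omega> \<le> real (L n \<omega>)" if "\<omega> \<in> space M" for \<omega>
        using that by (auto simp: B_def indicator_def)
    qed (use B in \<open>auto simp: emeasure_eq_measure\<close>)
    finally show ?thesis by (simp add: x_def)
  qed
  show ?thesis
    using c tail mean_LIS unfolding L_def by (intro exI[of _ c] conjI allI impI)
qed

end
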